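(* Let $r$ and $s$ be arbitrary positive integers, and let $d=(r,s)=\gcd(r,s)$. Let $G_{(r,s,1)}=\langle x,y\mid x^r,\,y^s,\,\gamma_2(F)\rangle$, where $F$ is the free group on $\{x,y\}$ (so $G_{(r,s,1)}\cong Z_r\times Z_s$). Then for any $c\ge 1$, $$\mathcal{N}_cM(G_{(r,s,1)})\cong \underbrace{Z_d\oplus\cdots\oplus Z_d}_{r(c+1)\ \text{copies}},$$ where $r(c+1)$ denotes the number of basic commutators of weight $c+1$ on two letters.
   Context: $Z_m$ denotes the cyclic group of order $m$. $\gamma_k(F)$ is the $k$-th term of the lower central series of $F$ (with $\gamma_1(F)=F$). $\mathcal{N}_c$ is the variety of nilpotent groups of class at most $c$. For a group $G$ with a free presentation $1\to R\to F\to G\to 1$ (with $F$ a free group), the Baer-invariant (higher Schur-multiplicator) of $G$ with respect to $\mathcal{N}_c$ is $$\mathcal{N}_cM(G)=\frac{R\cap\gamma_{c+1}(F)}{[R,\,{}_cF]},\qquad [R,\,{}_cF]=[R,\underbrace{F,\ldots,F}_{c}]$$ (left-normed commutator subgroup). It is an abelian group which is, up to isomorphism, independent of the choice of free presentation. The symbol $r(m)$ (a function of the weight $m$, not to be confused with a product involving the integer $r$) is the number of basic commutators of weight $m$ on two letters; equivalently, the rank of the free abelian group $\gamma_m(F)/\gamma_{m+1}(F)$ for $F$ free of rank $2$. *)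

theory Defs
  imports "HOL-Algebra.Algebra"
begin

section \<open>Free groups\<close>

text \<open>A letter \<open>(x, True)\<close> stands for the generator \<open>x\<close> and \<open>(x, False)\<close> for its inverse.
  Elements of the free group are reduced words.\<close>

type_synonym 'a word = "('a \<times> bool) list"

definition inv_letter :: "'a \<times> bool \<Rightarrow> 'a \<times> bool" where
  "inv_letter l = (fst l, \<not> snd l)"

definition reduced :: "'a word \<Rightarrow> bool" where
  "reduced w \<longleftrightarrow> successively (\<lambda>l l'. l' \<noteq> inv_letter l) w"

text \<open>\<open>push l w\<close> is the reduced form of \<open>l # w\<close> when \<open>w\<close> is reduced; hence
  \<open>foldr push u v\<close> is the reduced form of \<open>u @ v\<close> when \<open>v\<close> is reduced.\<close>

fun push :: "'a \<times> bool \<Rightarrow> 'a word \<Rightarrow> 'a word" where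
  "push l [] = [l]"
| "push l (l' # w) = (if l' = inv_letter l then w else l # l' # w)"

definition free_group :: "'a set \<Rightarrow> 'a word monoid" where
  "free_group A =
     \<lparr>carrier = {w. reduced w \<and> fst ` set w \<subseteq> A}, monoid.mult = (\<lambda>u v. foldr push u v), one = []\<rparr>"

definition free_gen :: "'a \<Rightarrow> 'a word" where
  "free_gen x = [(x, True)]"

text \<open>A basis of \<open>F\<close> is a subset of \<open>F\<close>, so an index set \<open>A\<close> over the type of the elements of \<open>F\<close>
  is always available.\<close>

definition is_free_group :: "('a, 'm) monoid_scheme \<Rightarrow> bool" where
  "is_free_group F \<longleftrightarrow> group F \<and> (\<exists>A :: 'a set. F \<cong> free_group A)"


section \<open>Commutator subgroups\<close>

text \<open>The commutators are written as in the library's \<^const>\<open>derived\<close>, that is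
  \<open>h k h\<inverse> k\<inverse>\<close>. For subgroups \<open>H\<close>, \<open>K\<close> the convention \<open>h\<inverse> k\<inverse> h k\<close> gives the same \<open>[H, K]\<close>.\<close>

definition comm_subgroup :: "('a, 'm) monoid_scheme \<Rightarrow> 'a set \<Rightarrow> 'a set \<Rightarrow> 'a set" where
  "comm_subgroup G H K =
     generate G (\<Union>h\<in>H. \<Union>k\<in>K. {h \<otimes>\<^bsub>G\<^esub> k \<otimes>\<^bsub>G\<^esub> inv\<^bsub>G\<^esub> h \<otimes>\<^bsub>G\<^esub> inv\<^bsub>G\<^esub> k})"

text \<open>\<open>iter_comm G R c\<close> is \<open>[R, G, \<dots>, G]\<close>, left-normed, with \<open>c\<close> copies of \<open>G\<close>.\<close>

primrec iter_comm :: "('a, 'm) monoid_scheme \<Rightarrow> 'a set \<Rightarrow> nat \<Rightarrow> 'a set" where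
  "iter_comm G R 0 = R"
| "iter_comm G R (Suc c) = comm_subgroup G (iter_comm G R c) (carrier G)"

text \<open>Numbered so that \<open>lower_central G 1 = carrier G\<close>; the value at \<open>0\<close> is irrelevant.\<close>

definition lower_central :: "('a, 'm) monoid_scheme \<Rightarrow> nat \<Rightarrow> 'a set" where
  "lower_central G k = iter_comm G (carrier G) (k - 1)"


section \<open>Presentations and the Baer invariant\<close>

definition normal_closure :: "('a, 'm) monoid_scheme \<Rightarrow> 'a set \<Rightarrow> 'a set" where
  "normal_closure G S = generate G (\<Union>g\<in>carrier G. \<Union>s\<in>S. {g \<otimes>\<^bsub>G\<^esub> s \<otimes>\<^bsub>G\<^esub> inv\<^bsub>G\<^esub> g})"

definition presented_group :: "'a set \<Rightarrow> 'a word set \<Rightarrow> 'a word set monoid" where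
  "presented_group A S = free_group A Mod normal_closure (free_group A) S"

text \<open>\<open>1 \<longrightarrow> R \<longrightarrow> F \<longrightarrow> G \<longrightarrow> 1\<close> with \<open>F\<close> free, for \<open>R\<close> a subset of \<open>F\<close>.\<close>

definition free_presentation ::
    "('a, 'm) monoid_scheme \<Rightarrow> 'a set \<Rightarrow> ('b, 'n) monoid_scheme \<Rightarrow> bool" where
  "free_presentation F R G \<longleftrightarrow>
     is_free_group F \<and> group G \<and> (\<exists>\<pi> \<in> epi F G. kernel F G \<pi> = R)"

text \<open>The group \<open>(R \<inter> \<gamma>\<^sub>c\<^sub>+\<^sub>1(F)) / [R, \<^sub>c F]\<close>.\<close>

definition baer_invariant :: "nat \<Rightarrow> ('a, 'm) monoid_scheme \<Rightarrow> 'a set \<Rightarrow> 'a set monoid" where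
  "baer_invariant c F R =
     F\<lparr>carrier := R \<inter> lower_central F (c + 1)\<rparr> Mod iter_comm F R c"

definition G_rs1 :: "'a \<Rightarrow> 'a \<Rightarrow> nat \<Rightarrow> nat \<Rightarrow> 'a word set monoid" where
  "G_rs1 x y r s =
     (let F = free_group {x, y} in
      presented_group {x, y}
        ({free_gen x [^]\<^bsub>F\<^esub> r, free_gen y [^]\<^bsub>F\<^esub> s} \<union> lower_central F 2))"


section \<open>Basic commutators\<close>

datatype 'a bracket = Letter 'a | Br "'a bracket" "'a bracket"

primrec weight :: "'a bracket \<Rightarrow> nat" where
  "weight (Letter a) = 1"
| "weight (Br u v) = weight u + weight v"

text \<open>Basic commutators are ordered by weight; those of equal weight may be ordered arbitrarily,
  and here they are ordered lexicographically. Their number in each weight does not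
  depend on this choice.\<close>

fun bracket_less :: "'a::linorder bracket \<Rightarrow> 'a bracket \<Rightarrow> bool" where
  "bracket_less (Letter a) (Letter b) \<longleftrightarrow> a < b"
| "bracket_less (Letter a) (Br u v) \<longleftrightarrow> True"
| "bracket_less (Br u v) (Letter a) \<longleftrightarrow> False"
| "bracket_less (Br u v) (Br u' v') \<longleftrightarrow>
     weight (Br u v) < weight (Br u' v') \<or>
     weight (Br u v) = weight (Br u' v') \<and>
       (bracket_less u u' \<or> u = u' \<and> bracket_less v v')"

text \<open>\<open>[u, v]\<close> is basic iff \<open>u\<close> and \<open>v\<close> are basic, \<open>u > v\<close>, and, if
  \<open>u = [u\<^sub>1, u\<^sub>2]\<close>, also \<open>v \<ge> u\<^sub>2\<close>.\<close>

fun basic :: "'a::linorder bracket \<Rightarrow> bool" where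
  "basic (Letter a) \<longleftrightarrow> True"
| "basic (Br u v) \<longleftrightarrow>
     basic u \<and> basic v \<and> bracket_less v u \<and>
     (case u of Letter a \<Rightarrow> True | Br u1 u2 \<Rightarrow> \<not> bracket_less v u2)"

text \<open>Basic commutators of weight \<open>m\<close> on \<open>n\<close> letters, the letters being \<open>0, \<dots>, n - 1\<close>.\<close>

definition num_basic_commutators :: "nat \<Rightarrow> nat \<Rightarrow> nat" where
  "num_basic_commutators n m =
     card {b :: nat bracket. set_bracket b \<subseteq> {..<n} \<and> basic b \<and> weight b = m}"

end

theory Submission
  imports Defs
begin

text \<open>Two free presentations of the same group are compared by lifting the identity to
  homomorphisms between the free groups. A lift \<open>\<phi>\<close> of the identity to an endomorphism of \<open>F\<close>
  moves elements only by elements of \<open>R\<close>, hence moves \<open>\<gamma>\<^sub>c\<^sub>+\<^sub>1(F)\<close> only within \<open>[R, \<^sub>c F]\<close>,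
  because \<open>[\<gamma>\<^sub>k(F), R]\<close> is contained in \<open>[R, \<^sub>k F]\<close>. So it suffices to treat \<open>F\<close> free on \<open>x\<close>, \<open>y\<close>
  with \<open>R\<close> generated by \<open>x\<^sup>r\<close>, \<open>y\<^sup>s\<close> and \<open>\<gamma>\<^sub>2(F)\<close>. There \<open>[R, \<^sub>c F]\<close> consists of the elements of
  \<open>\<gamma>\<^sub>c\<^sub>+\<^sub>1(F)\<close> that are \<open>d\<close>-th powers modulo \<open>\<gamma>\<^sub>c\<^sub>+\<^sub>2(F)\<close>: the commutator \<open>[x, y]\<close> occurs with the
  exponents \<open>r\<close> and \<open>s\<close>, and higher commutators inherit this by linearity.

  It remains to see that \<open>\<gamma>\<^sub>n(F)/\<gamma>\<^sub>n\<^sub>+\<^sub>1(F)\<close> is free abelian on the basic commutators of weight \<open>n\<close>.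
  They generate by a rewriting argument with the Jacobi identity. They are independent because their
  leading terms in the Magnus representation \<open>x \<mapsto> 1 + X\<^sub>0\<close>, \<open>y \<mapsto> 1 + X\<^sub>1\<close> are: the increasing products of
  basic Lie elements of total weight \<open>n\<close> span the homogeneous part of degree \<open>n\<close> of the free
  associative algebra, and there are at most as many of them as words of length \<open>n\<close>.\<close>

section \<open>Series in noncommuting variables\<close>

text \<open>Because \<open>lower_central F 2\<close> lies in R, \<open>iter_comm F R c\<close>
  contains \<open>lower_central F (c + 2)\<close>. The computation therefore lives in the single
  abelian quotient gamma_{c+1}/gamma_{c+2}. Subgroups between two consecutive terms are
  automatically normal, so congruences modulo the next term can be handled as membership in normal
  subgroups and checked on generators. The obstacle is independence, since rewriting only shows that
  there are enough basic commutators. The Magnus image supplies an invariant: its degree n part is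
  additive on gamma_n and sends a basic commutator of weight n to its Lie polynomial. Infinite
  series make 1 + X invertible, and real coefficients permit a dimension count. Integrality is
  recovered on the group side: an element of gamma_n is, modulo gamma_{n+1}, a product of integer
  powers of basic commutators. Its leading term thus has integer coordinates, and their divisibility
  by d detects the d-th powers.\<close>

typedef series = "UNIV :: (nat list \<Rightarrow> real) set"
  morphisms coeff Series ..

lemma coeff_Series [simp]: "coeff (Series f) = f"
  by (simp add: Series_inverse)

lemma series_eqI: "(\<And>w. coeff f w = coeff g w) \<Longrightarrow> f = g"
  by (metis coeff_inject ext)

text \<open>The Cauchy product, a sum over all ways to cut the word into a prefix for
  \<open>f\<close> and a suffix for \<open>g\<close>. Either the prefix is empty or its first letter
  is absorbed into \<open>f\<close>; with this recursion the algebra laws become inductions on the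
  word.\<close>

fun conv :: "(nat list \<Rightarrow> real) \<Rightarrow> (nat list \<Rightarrow> real) \<Rightarrow> nat list \<Rightarrow> real" where
  "conv f g [] = f [] * g []"
| "conv f g (a # w) = f [] * g (a # w) + conv (\<lambda>v. f (a # v)) g w"

lemma conv_add_left: "conv (\<lambda>v. f v + g v) h w = conv f h w + conv g h w"
  by (induction w arbitrary: f g) (auto simp: algebra_simps)

lemma conv_add_right: "conv f (\<lambda>v. g v + h v) w = conv f g w + conv f h w"
  by (induction w arbitrary: f) (auto simp: algebra_simps)

lemma conv_scale_left: "conv (\<lambda>v. c * f v) g w = c * conv f g w"
  by (induction w arbitrary: f) (auto simp: algebra_simps)

lemma conv_scale_right: "conv f (\<lambda>v. c * g v) w = c * conv f g w"
  by (induction w arbitrary: f) (auto simp: algebra_simps)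

lemma conv_zero_left: "conv (\<lambda>v. 0) g w = 0"
  by (induction w) auto

lemma conv_assoc: "conv (conv f g) h w = conv f (conv g h) w"
  by (induction w arbitrary: f g)
     (simp_all add: conv_add_left conv_scale_left algebra_simps)

lemma conv_one_left: "conv (\<lambda>v. if v = [] then 1 else 0) g w = g w"
  by (cases w) (simp_all add: conv_zero_left)

lemma conv_one_right: "conv f (\<lambda>v. if v = [] then 1 else 0) w = f w"
  by (induction w arbitrary: f) simp_all

instantiation series :: real_algebra_1
begin

definition "0 = Series (\<lambda>_. 0)"
definition "1 = Series (\<lambda>w. if w = [] then 1 else 0)"
definition "f + g = Series (\<lambda>w. coeff f w + coeff g w)"
definition "f - g = Series (\<lambda>w. coeff f w - coeff g w)"
definition "- f = Series (\<lambda>w. - coeff f w)" for f :: series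
definition "f * g = Series (conv (coeff f) (coeff g))"
definition "r *\<^sub>R f = Series (\<lambda>w. r * coeff f w)"

lemma coeff_simps [simp]:
  "coeff 0 w = 0"
  "coeff 1 w = (if w = [] then 1 else 0)"
  "coeff (f + g) w = coeff f w + coeff g w"
  "coeff (f - g) w = coeff f w - coeff g w"
  "coeff (- f) w = - coeff f w"
  "coeff (r *\<^sub>R f) w = r * coeff f w"
  by (simp_all add: zero_series_def one_series_def plus_series_def minus_series_def
      uminus_series_def scaleR_series_def)

lemma coeff_mult: "coeff (f * g) w = conv (coeff f) (coeff g) w"
  by (simp add: times_series_def)

instance
proof
  fix f g h :: series
  show "(f * g) * h = f * (g * h)"
    by (simp add: times_series_def ext[OF conv_assoc])
  show "1 * f = f"
    by (rule series_eqI) (simp add: times_series_def one_series_def conv_one_left)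
  show "f * 1 = f"
    by (rule series_eqI) (simp add: times_series_def one_series_def conv_one_right)
  show "(f + g) * h = f * h + g * h" and "f * (g + h) = f * g + f * h"
    by (rule series_eqI; simp add: times_series_def plus_series_def conv_add_left conv_add_right)+
  have "coeff (0 :: series) [] \<noteq> coeff 1 []"
    by simp
  then show "(0 :: series) \<noteq> 1"
    by metis
  show "r *\<^sub>R f * g = r *\<^sub>R (f * g)" and "f * r *\<^sub>R g = r *\<^sub>R (f * g)" for r
    by (rule series_eqI; simp add: times_series_def scaleR_series_def conv_scale_left conv_scale_right)+
qed (rule series_eqI, simp add: algebra_simps)+

end

lemma coeff_sum [simp]: "coeff (sum f A) w = (\<Sum>i\<in>A. coeff (f i) w)"
  by (induction A rule: infinite_finite_induct) auto

definition var :: "nat \<Rightarrow> series" where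
  "var a = Series (\<lambda>w. if w = [a] then 1 else 0)"

lemma coeff_var [simp]: "coeff (var a) w = (if w = [a] then 1 else 0)"
  by (simp add: var_def)

lemma coeff_var_mult [simp]:
  "coeff (var a * f) [] = 0"
  "coeff (var a * f) (b # w) = (if b = a then coeff f w else 0)"
proof -
  have "coeff (1 * f) w = coeff f w"
    by simp
  then have "conv (\<lambda>v. if v = [] then 1 else 0) (coeff f) w = coeff f w"
    unfolding coeff_mult by (simp add: one_series_def)
  then show "coeff (var a * f) (b # w) = (if b = a then coeff f w else 0)"
    by (simp add: coeff_mult conv_zero_left)
qed (simp add: coeff_mult)

lemma coeff_prod_list_var: "coeff (prod_list (map var v)) w = (if w = v then 1 else 0)"
proof (induction v arbitrary: w)
  case (Cons a v)
  then show ?case by (cases w) auto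
qed simp

section \<open>Basic commutators\<close>

lemma weight_pos [simp]: "weight b > 0"
  by (induction b) auto

lemma weight_neq_0 [simp]: "weight b \<noteq> 0"
  using weight_pos[of b] by simp

lemma bracket_less_irrefl [simp]: "\<not> bracket_less b b"
  by (induction b) auto

lemma bracket_less_total: "bracket_less u v \<or> u = v \<or> bracket_less v u"
proof (induction u arbitrary: v)
  case (Letter a)
  then show ?case by (cases v) auto
next
  case (Br u1 u2)
  show ?case
  proof (cases v)
    case v: (Br v1 v2)
    have "weight u < weight v \<or> weight u = weight v \<or> weight v < weight u" for u v :: "'a bracket"
      by linarith
    then show ?thesis
      using Br.IH(1)[of v1] Br.IH(2)[of v2] by (auto simp: v)
  qed simp
qed

lemma bracket_less_trans: "bracket_less u v \<Longrightarrow> bracket_less v w \<Longrightarrow> bracket_less u w"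
proof (induction u arbitrary: v w)
  case (Letter a)
  then show ?case by (cases v; cases w) auto
next
  case (Br u1 u2)
  then obtain v1 v2 where v: "v = Br v1 v2" by (cases v) auto
  with Br.prems obtain w1 w2 where w: "w = Br w1 w2" by (cases w) auto
  from Br.prems show ?case
    unfolding v w by (auto dest: Br.IH)
qed

lemma bracket_less_weight: "weight u < weight v \<Longrightarrow> bracket_less u v"
  by (cases u; cases v) auto

abbreviation bracket_le :: "'a::linorder bracket \<Rightarrow> 'a bracket \<Rightarrow> bool" where
  "bracket_le u v \<equiv> \<not> bracket_less v u"

lemma bracket_less_imp_le: "bracket_less u v \<Longrightarrow> bracket_le u v"
  using bracket_less_trans bracket_less_irrefl by blast

lemma bracket_less_le_trans: "bracket_less u v \<Longrightarrow> bracket_le v w \<Longrightarrow> bracket_less u w"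
  by (metis bracket_less_total bracket_less_trans)

lemma bracket_le_trans: "bracket_le u v \<Longrightarrow> bracket_le v w \<Longrightarrow> bracket_le u w"
  by (metis bracket_less_le_trans)

text \<open>The second condition in the definition of a basic bracket, imposed for all entries of a
  sequence at once: it is the invariant that keeps \<open>Br h k\<close> basic while
  \<open>h\<close> travels to the right through \<open>s\<close>.\<close>

fun fits :: "'a::linorder bracket \<Rightarrow> 'a bracket list \<Rightarrow> bool" where
  "fits (Letter a) s \<longleftrightarrow> True"
| "fits (Br u v) s \<longleftrightarrow> (\<forall>k\<in>set s. bracket_le v k)"

lemma basic_Br: "basic (Br u v) \<longleftrightarrow> basic u \<and> basic v \<and> bracket_less v u \<and> fits u [v]"
  by (cases u) auto

declare basic.simps(2) [simp del]

lemma fits_mono: "fits h s \<Longrightarrow> set t \<subseteq> set s \<Longrightarrow> fits h t"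
  by (cases h) auto

text \<open>The right factor of a bracket has smaller weight than the bracket, hence precedes it in
  the order and precedes whatever the bracket precedes.\<close>

lemma fits_if_less: "\<forall>k\<in>set s. bracket_le h k \<Longrightarrow> fits h s"
proof (cases h)
  case (Br u v)
  assume "\<forall>k\<in>set s. bracket_le h k"
  moreover have "bracket_less v h"
    using Br by (simp add: bracket_less_weight)
  ultimately show ?thesis
    using Br by (auto dest: bracket_less_trans)
qed simp

section \<open>Increasing sequences of basic commutators and the words they spell\<close>

abbreviation increasing :: "'a::linorder bracket list \<Rightarrow> bool" where
  "increasing \<equiv> sorted_wrt bracket_le"

primrec foliage :: "'a bracket \<Rightarrow> 'a list" where
  "foliage (Letter a) = [a]"
| "foliage (Br u v) = foliage u @ foliage v"

fun insert_basic :: "'a::linorder bracket \<Rightarrow> 'a bracket list \<Rightarrow> 'a bracket list" where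
  "insert_basic h [] = [h]"
| "insert_basic h (k # s) = (if bracket_less k h then insert_basic (Br h k) s else h # k # s)"

lemma length_foliage [simp]: "length (foliage b) = weight b"
  by (induction b) auto

lemma set_foliage [simp]: "set (foliage b) = set_bracket b"
  by (induction b) auto

text \<open>Reading a word from the right and bracketing greedily recovers the increasing sequence
  of basic commutators that the word is the foliage of.\<close>

lemma foldr_insert_basic_foliage:
  "basic h \<Longrightarrow> increasing s \<Longrightarrow> fits h s \<Longrightarrow>
    foldr (\<lambda>a. insert_basic (Letter a)) (foliage h) s = insert_basic h s"
proof (induction h arbitrary: s)
  case (Br u v)
  then have uv: "basic u" "basic v" "bracket_less v u" "fits u [v]" and le: "\<forall>k\<in>set s. bracket_le v k"
    by (auto simp: basic_Br)
  have "foldr (\<lambda>a. insert_basic (Letter a)) (foliage v) s = insert_basic v s"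
    using Br.prems uv le by (intro Br.IH fits_if_less) auto
  also have "\<dots> = v # s"
    using le by (cases s) auto
  finally have v: "foldr (\<lambda>a. insert_basic (Letter a)) (foliage v) s = v # s" .
  have "fits u (v # s)"
    using uv le by (cases u) (auto dest: bracket_less_le_trans)
  then have "foldr (\<lambda>a. insert_basic (Letter a)) (foliage u) (v # s) = insert_basic u (v # s)"
    using Br.prems uv le by (intro Br.IH) auto
  \<comment> \<open>As \<open>v\<close> precedes \<open>u\<close>, inserting \<open>u\<close> merges
    it with \<open>v\<close> at once and continues with \<open>Br u v\<close> on
    \<open>s\<close>.\<close>
  then show ?case
    using uv by (simp add: v)
qed simp

lemma foldr_insert_basic_concat:
  assumes "increasing s" and "\<forall>b\<in>set s. basic b"
  shows "foldr (\<lambda>a. insert_basic (Letter a)) (concat (map foliage s)) [] = s"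
  using assms
proof (induction s)
  case (Cons h s)
  then have "foldr (\<lambda>a. insert_basic (Letter a)) (foliage h) s = insert_basic h s"
    by (intro foldr_insert_basic_foliage fits_if_less) auto
  moreover have "insert_basic h s = h # s"
    using Cons.prems by (cases s) auto
  ultimately show ?case
    using Cons by simp
qed simp

definition basics :: "nat \<Rightarrow> nat \<Rightarrow> nat bracket set" where
  "basics q n = {b. set_bracket b \<subseteq> {..<q} \<and> basic b \<and> weight b = n}"

definition basic_seqs :: "nat \<Rightarrow> nat \<Rightarrow> nat bracket list set" where
  "basic_seqs q n =
     {s. increasing s \<and> (\<forall>b\<in>set s. set_bracket b \<subseteq> {..<q} \<and> basic b) \<and> sum_list (map weight s) = n}"

text \<open>Concatenating the foliages is injective because greedy bracketing inverts it. This upper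
  bound is the counting half of a Poincare-Birkhoff-Witt argument; the other half is the spanning
  result \<open>var_prod_in_span\<close>.\<close>

lemma finite_basic_seqs: "finite (basic_seqs q n)"
  and card_basic_seqs: "card (basic_seqs q n) \<le> q ^ n"
proof -
  let ?W = "{w. set w \<subseteq> {..<q} \<and> length w = n}"
  let ?f = "\<lambda>s. concat (map foliage s)"
  have inj: "inj_on ?f (basic_seqs q n)"
    by (rule inj_on_inverseI[where g = "\<lambda>w. foldr (\<lambda>a. insert_basic (Letter a)) w []"])
       (use foldr_insert_basic_concat in \<open>auto simp: basic_seqs_def\<close>)
  have sub: "?f ` basic_seqs q n \<subseteq> ?W"
    by (force simp: basic_seqs_def length_concat comp_def)
  have fin: "finite ?W"
    by (intro finite_lists_length_eq) simp
  show "finite (basic_seqs q n)"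
    using inj sub fin by (rule inj_on_finite)
  have "card (basic_seqs q n) \<le> card ?W"
    using inj sub fin by (rule card_inj_on_le)
  then show "card (basic_seqs q n) \<le> q ^ n"
    by (simp add: card_lists_length_eq)
qed

lemma singleton_basic_seqs: "b \<in> basics q n \<Longrightarrow> [b] \<in> basic_seqs q n"
  by (auto simp: basics_def basic_seqs_def)

lemma finite_basics: "finite (basics q n)"
proof (rule finite_imageD)
  show "finite ((\<lambda>b. [b]) ` basics q n)"
    by (rule finite_subset[OF _ finite_basic_seqs]) (auto intro: singleton_basic_seqs)
qed (simp add: inj_on_def)

lemma card_basics: "card (basics q n) = num_basic_commutators q n"
  by (simp add: basics_def num_basic_commutators_def)

section \<open>Linear independence of the basic commutators\<close>

primrec lie :: "nat bracket \<Rightarrow> series" where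
  "lie (Letter a) = var a"
| "lie (Br u v) = lie u * lie v - lie v * lie u"

abbreviation lie_prod :: "nat bracket list \<Rightarrow> series" where
  "lie_prod s \<equiv> prod_list (map lie s)"

lemma span_mult_left:
  assumes "\<And>x. x \<in> B \<Longrightarrow> a * x \<in> span Y" and "z \<in> span B"
  shows "(a :: series) * z \<in> span Y"
  using assms(2)
  by (induction rule: span_induct_alt)
     (use assms(1) in \<open>auto simp: distrib_left intro: span_zero span_add span_scale\<close>)

text \<open>The rewriting step is \<open>h k = [h, k] + k h\<close>; the lower bound \<open>m\<close> ensures that the
  factor \<open>k\<close> moved to the front stays in order.\<close>

lemma lie_mult_in_span:
  assumes "basic h" "set_bracket h \<subseteq> {..<q}" "s \<in> basic_seqs q n" "fits h s"
    and "\<forall>b\<in>set (h # s). bracket_le m b"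
  shows "lie h * lie_prod s \<in> span (lie_prod ` {t \<in> basic_seqs q (weight h + n). \<forall>b\<in>set t. bracket_le m b})"
  using assms
proof (induction s arbitrary: h n m)
  case Nil
  then have "[h] \<in> {t \<in> basic_seqs q (weight h + n). \<forall>b\<in>set t. bracket_le m b}"
    by (auto simp: basic_seqs_def)
  then show ?case
    by (intro span_base image_eqI[of _ _ "[h]"]) auto
next
  case (Cons k s)
  show ?case
  proof (cases "bracket_less k h")
    case False
    have "\<not> bracket_less b h" if "b \<in> set s" for b
    proof -
      have "\<not> bracket_less b k"
        using Cons.prems(3) that by (auto simp: basic_seqs_def)
      with False show ?thesis
        by (meson bracket_le_trans)
    qed
    then have "h # k # s \<in> {t \<in> basic_seqs q (weight h + n). \<forall>b\<in>set t. bracket_le m b}"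
      using Cons.prems False by (auto simp: basic_seqs_def)
    then show ?thesis
      by (intro span_base image_eqI[of _ _ "h # k # s"]) auto
  next
    case True
    let ?n = "n - weight k"
    have n: "n = weight k + ?n" and s: "s \<in> basic_seqs q ?n" and k: "basic k" "set_bracket k \<subseteq> {..<q}"
      and ks: "\<forall>b\<in>set s. bracket_le k b"
      using Cons.prems(3) by (auto simp: basic_seqs_def)
    have "lie (Br h k) * lie_prod s
        \<in> span (lie_prod ` {t \<in> basic_seqs q (weight (Br h k) + ?n). \<forall>b\<in>set t. bracket_le m b})"
    proof (rule Cons.IH)
      \<comment> \<open>The bracket is basic since \<open>h\<close> fits the sequence headed by
        \<open>k\<close>, and it fits \<open>s\<close> since its right factor \<open>k\<close> is a
        lower bound of \<open>s\<close>.\<close>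
      show "basic (Br h k)"
        using Cons.prems True k by (auto simp: basic_Br elim: fits_mono)
      have "bracket_less k (Br h k)"
        by (simp add: bracket_less_weight)
      then show "\<forall>b\<in>set (Br h k # s). bracket_le m b"
        using Cons.prems(5) by (auto dest: bracket_less_trans)
    qed (use Cons.prems k s ks in auto)
    then have 1: "lie (Br h k) * lie_prod s
        \<in> span (lie_prod ` {t \<in> basic_seqs q (weight h + n). \<forall>b\<in>set t. bracket_le m b})"
      using n by (simp add: add.assoc)
    have 2: "lie h * lie_prod s
        \<in> span (lie_prod ` {t \<in> basic_seqs q (weight h + ?n). \<forall>b\<in>set t. bracket_le k b})"
    proof (rule Cons.IH)
      show "\<forall>b\<in>set (h # s). bracket_le k b"
        using ks True by (simp add: bracket_less_imp_le)
      show "fits h s"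
        using Cons.prems(4) by (rule fits_mono) auto
    qed (use Cons.prems s in auto)
    have 3: "lie k * lie_prod t
        \<in> span (lie_prod ` {t \<in> basic_seqs q (weight h + n). \<forall>b\<in>set t. bracket_le m b})"
      if "t \<in> basic_seqs q (weight h + ?n)" "\<forall>b\<in>set t. bracket_le k b" for t
    proof (rule span_base, rule image_eqI)
      show "k # t \<in> {t \<in> basic_seqs q (weight h + n). \<forall>b\<in>set t. bracket_le m b}"
        using that k n Cons.prems(5) bracket_le_trans[of k m]
        by (auto simp: basic_seqs_def)
    qed simp
    have "lie k * (lie h * lie_prod s)
        \<in> span (lie_prod ` {t \<in> basic_seqs q (weight h + n). \<forall>b\<in>set t. bracket_le m b})"
      using 2 by (rule span_mult_left[rotated]) (use 3 in auto)
    from span_add[OF 1 this] show ?thesis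
      by (simp add: algebra_simps)
  qed
qed

lemma var_prod_in_span:
  "set w \<subseteq> {..<q} \<Longrightarrow> prod_list (map var w) \<in> span (lie_prod ` basic_seqs q (length w))"
proof (induction w)
  case Nil
  have "[] \<in> basic_seqs q 0"
    by (simp add: basic_seqs_def)
  then show ?case
    by (intro span_base image_eqI[of _ _ "[]"]) auto
next
  case (Cons a w)
  have "var a * lie_prod s \<in> span (lie_prod ` basic_seqs q (Suc (length w)))"
    if s: "s \<in> basic_seqs q (length w)" for s
  proof -
    \<comment> \<open>The rewriting lemma asks for some lower bound of the sequence. Any one will do
      here, because it is forgotten again by monotonicity of the span.\<close>
    have bot: "\<exists>m. \<forall>b\<in>set t. bracket_le m b" for t :: "nat bracket list"
    proof (induction t)
      case (Cons b t)
      then obtain m where m: "\<forall>b\<in>set t. bracket_le m b" by blast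
      show ?case
      proof (cases "bracket_less b m")
        case True
        then have "\<forall>c\<in>set (b # t). bracket_le b c"
          using m bracket_less_imp_le bracket_less_le_trans by fastforce
        then show ?thesis by blast
      qed (use m in auto)
    qed simp
    then obtain m where "\<forall>b\<in>set (Letter a # s). bracket_le m b"
      by blast
    with lie_mult_in_span[of "Letter a" q s "length w" m] s Cons.prems
    have "lie (Letter a) * lie_prod s
        \<in> span (lie_prod ` {t \<in> basic_seqs q (Suc (length w)). \<forall>b\<in>set t. bracket_le m b})"
      by auto
    then show ?thesis
      using span_mono[of "lie_prod ` {t \<in> basic_seqs q (Suc (length w)). \<forall>b\<in>set t. bracket_le m b}"
          "lie_prod ` basic_seqs q (Suc (length w))"] by auto
  qed
  moreover have "prod_list (map var w) \<in> span (lie_prod ` basic_seqs q (length w))"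
    using Cons by simp
  ultimately show ?case
    using span_mult_left[of "lie_prod ` basic_seqs q (length w)" "var a"] by auto
qed

text \<open>A dimension count: at most \<open>q ^ n\<close> products span a space containing the
  \<open>q ^ n\<close> independent monomials of degree n, so no product can coincide with another or
  be redundant.\<close>

lemma independent_lie_prod:
  "inj_on lie_prod (basic_seqs q n)" "\<not> Real_Vector_Spaces.dependent (lie_prod ` basic_seqs q n)"
proof -
  let ?I = "basic_seqs q n" and ?d = "\<lambda>w. prod_list (map var w)"
  define W where "W = {w. set w \<subseteq> {..<q} \<and> length w = n}"
  have finW: "finite W"
    unfolding W_def by (intro finite_lists_length_eq) simp
  have cardW: "card W = q ^ n"
    unfolding W_def by (simp add: card_lists_length_eq)
  have inj: "inj ?d"
  proof (rule injI)
    fix v w assume "?d v = ?d w"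
    then have "coeff (?d v) v = coeff (?d w) v"
      by simp
    then show "v = w"
      by (simp add: coeff_prod_list_var split: if_splits)
  qed
  have ind: "\<not> Real_Vector_Spaces.dependent (?d ` W)"
  proof
    assume "Real_Vector_Spaces.dependent (?d ` W)"
    then obtain u v where v: "v \<in> W" "u (?d v) \<noteq> 0" and "(\<Sum>f\<in>?d ` W. u f *\<^sub>R f) = 0"
      using finW by (auto simp: real_vector.dependent_finite)
    then have "(\<Sum>w\<in>W. u (?d w) *\<^sub>R ?d w) = 0"
      using inj by (subst (asm) sum.reindex) (auto intro: inj_on_subset)
    then have "coeff (\<Sum>w\<in>W. u (?d w) *\<^sub>R ?d w) v = 0"
      by simp
    then show False
      using v finW by (simp add: coeff_prod_list_var if_distrib[of "(*) _"] cong: if_cong)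
  qed
  have sub: "?d ` W \<subseteq> span (lie_prod ` ?I)"
    by (auto simp: W_def intro: var_prod_in_span)
  \<comment> \<open>Every finite set spanning the products also spans the monomials. Applied to all
    products it yields injectivity, applied to the products without a dependent one it yields a
    contradiction.\<close>
  have bound: "q ^ n \<le> card T" if "finite T" "lie_prod ` ?I \<subseteq> span T" for T
  proof -
    have "?d ` W \<subseteq> span T"
      using sub span_minimal[OF that(2) subspace_span] by blast
    with that(1) ind have "card (?d ` W) \<le> card T"
      using real_vector.independent_span_bound by blast
    then show ?thesis
      using inj cardW by (metis card_image inj_on_subset subset_UNIV)
  qed
  have card: "card (lie_prod ` ?I) = card ?I"
    using bound[of "lie_prod ` ?I"] card_basic_seqs[of q n] card_image_le[OF finite_basic_seqs, of lie_prod q n]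
    by (simp add: finite_basic_seqs span_superset)
  then show "inj_on lie_prod ?I"
    by (simp add: eq_card_imp_inj_on finite_basic_seqs)
  show "\<not> Real_Vector_Spaces.dependent (lie_prod ` ?I)"
  proof
    assume "Real_Vector_Spaces.dependent (lie_prod ` ?I)"
    then obtain a where a: "a \<in> lie_prod ` ?I" "a \<in> span (lie_prod ` ?I - {a})"
      by (auto simp: real_vector.dependent_def)
    have "lie_prod ` ?I \<subseteq> span (lie_prod ` ?I - {a})"
      using a(2) span_superset[of "lie_prod ` ?I - {a}"] by blast
    then have "q ^ n \<le> card (lie_prod ` ?I - {a})"
      by (intro bound) (simp_all add: finite_basic_seqs)
    also have "\<dots> < card (lie_prod ` ?I)"
      using a(1) by (intro psubset_card_mono) (auto simp: finite_basic_seqs)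
    finally show False
      using card card_basic_seqs[of q n] by simp
  qed
qed

text \<open>A basic commutator is an increasing sequence of length one, so its Lie element is among
  the independent products.\<close>

lemma lie_basics_independent:
  assumes "(\<Sum>b\<in>basics q n. c b *\<^sub>R lie b) = 0" and "b \<in> basics q n"
  shows "c b = 0"
proof -
  have inj: "inj_on lie (basics q n)"
  proof (rule inj_onI)
    fix u v assume "u \<in> basics q n" "v \<in> basics q n" "lie u = lie v"
    then have "[u] = [v]"
      by (intro inj_onD[OF independent_lie_prod(1)] singleton_basic_seqs) auto
    then show "u = v" by simp
  qed
  have "lie ` basics q n \<subseteq> lie_prod ` basic_seqs q n"
  proof clarify
    fix u assume "u \<in> basics q n"
    then show "lie u \<in> lie_prod ` basic_seqs q n"
      by (intro image_eqI[of _ _ "[u]"] singleton_basic_seqs) auto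
  qed
  then have ind: "\<not> Real_Vector_Spaces.dependent (lie ` basics q n)"
    using independent_lie_prod(2) real_vector.dependent_mono by blast
  have "(\<Sum>f\<in>lie ` basics q n. c (inv_into (basics q n) lie f) *\<^sub>R f) = 0"
    using assms(1) by (subst sum.reindex) (auto simp: inj)
  with ind have "c (inv_into (basics q n) lie (lie b)) = 0"
    using assms(2) finite_basics by (auto simp: real_vector.dependent_finite)
  then show ?thesis
    using inj assms(2) by simp
qed

section \<open>Commutator calculus\<close>

definition commutator :: "('a, 'm) monoid_scheme \<Rightarrow> 'a \<Rightarrow> 'a \<Rightarrow> 'a" where
  "commutator G g h = g \<otimes>\<^bsub>G\<^esub> h \<otimes>\<^bsub>G\<^esub> inv\<^bsub>G\<^esub> g \<otimes>\<^bsub>G\<^esub> inv\<^bsub>G\<^esub> h"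

context group
begin

lemma inv_mult_cancel [simp]:
  "x \<in> carrier G \<Longrightarrow> y \<in> carrier G \<Longrightarrow> inv x \<otimes> (x \<otimes> y) = y"
  "x \<in> carrier G \<Longrightarrow> y \<in> carrier G \<Longrightarrow> x \<otimes> (inv x \<otimes> y) = y"
  by (simp_all flip: m_assoc)

lemma commutator_closed [simp]:
  "g \<in> carrier G \<Longrightarrow> h \<in> carrier G \<Longrightarrow> commutator G g h \<in> carrier G"
  by (simp add: commutator_def)

lemma commutator_self [simp]: "g \<in> carrier G \<Longrightarrow> commutator G g g = \<one>"
  by (simp add: commutator_def m_assoc)

lemma inv_commutator:
  "g \<in> carrier G \<Longrightarrow> h \<in> carrier G \<Longrightarrow> inv (commutator G g h) = commutator G h g"
  by (simp add: commutator_def m_assoc inv_mult_group)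

lemma commutator_mult_left:
  "g \<in> carrier G \<Longrightarrow> g' \<in> carrier G \<Longrightarrow> h \<in> carrier G \<Longrightarrow>
    commutator G (g \<otimes> g') h = g \<otimes> commutator G g' h \<otimes> inv g \<otimes> commutator G g h"
  by (simp add: commutator_def m_assoc inv_mult_group)

lemma commutator_inv_left:
  "g \<in> carrier G \<Longrightarrow> h \<in> carrier G \<Longrightarrow>
    commutator G (inv g) h = inv g \<otimes> commutator G h g \<otimes> g"
  by (simp add: commutator_def m_assoc inv_mult_group)

lemma conj_commutator:
  "x \<in> carrier G \<Longrightarrow> g \<in> carrier G \<Longrightarrow> h \<in> carrier G \<Longrightarrow>
    x \<otimes> commutator G g h \<otimes> inv x = commutator G (x \<otimes> g \<otimes> inv x) (x \<otimes> h \<otimes> inv x)"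
  by (simp add: commutator_def m_assoc inv_mult_group)

lemma conj_eq_commutator:
  "g \<in> carrier G \<Longrightarrow> h \<in> carrier G \<Longrightarrow> g \<otimes> h \<otimes> inv g = inv (commutator G h g) \<otimes> h"
  by (simp add: commutator_def m_assoc inv_mult_group)

lemma normal_inv_op_iff:
  assumes "N \<lhd> G" "x \<in> carrier G" "h \<in> carrier G"
  shows "x \<otimes> h \<otimes> inv x \<in> N \<longleftrightarrow> h \<in> N"
proof
  assume "x \<otimes> h \<otimes> inv x \<in> N"
  then have "inv x \<otimes> (x \<otimes> h \<otimes> inv x) \<otimes> x \<in> N"
    by (rule normal.inv_op_closed1[OF assms(1,2)])
  with assms show "h \<in> N"
    by (simp add: m_assoc)
qed (use assms normal_invE in blast)

lemma commutator_swap_iff: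
  assumes "subgroup S G" "g \<in> carrier G" "h \<in> carrier G"
  shows "commutator G g h \<in> S \<longleftrightarrow> commutator G h g \<in> S"
  using assms by (metis inv_commutator subgroup.m_inv_closed)

text \<open>Follows from [gg', h] = g [g', h] g^-1 [g, h]. It is the device by which a statement on
  commutators modulo a normal subgroup is reduced to generators.\<close>

lemma subgroup_commutator_left:
  assumes "N \<lhd> G" "h \<in> carrier G"
  shows "subgroup {g \<in> carrier G. commutator G g h \<in> N} G"
proof
  show "\<one> \<in> {g \<in> carrier G. commutator G g h \<in> N}"
    using assms by (simp add: commutator_def normal_imp_subgroup subgroup.one_closed)
next
  fix x y assume "x \<in> {g \<in> carrier G. commutator G g h \<in> N}" "y \<in> {g \<in> carrier G. commutator G g h \<in> N}"
  then show "x \<otimes> y \<in> {g \<in> carrier G. commutator G g h \<in> N}"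
    using assms normal_invE[OF assms(1)] by (simp add: commutator_mult_left subgroup.m_closed)
next
  fix x assume x: "x \<in> {g \<in> carrier G. commutator G g h \<in> N}"
  then have "commutator G h x \<in> N"
    using assms commutator_swap_iff normal_imp_subgroup by blast
  then show "inv x \<in> {g \<in> carrier G. commutator G g h \<in> N}"
    using assms x by (simp add: commutator_inv_left normal.inv_op_closed1)
qed auto

lemma commutator_inv_left_iff:
  assumes "N \<lhd> G" "g \<in> carrier G" "h \<in> carrier G"
  shows "commutator G (inv g) h \<in> N \<longleftrightarrow> commutator G g h \<in> N"
  using subgroup.m_inv_closed[OF subgroup_commutator_left[OF assms(1,3)], of g]
    subgroup.m_inv_closed[OF subgroup_commutator_left[OF assms(1,3)], of "inv g"] assms(2)
  by auto

lemma commutator_inv_right_iff: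
  assumes "N \<lhd> G" "g \<in> carrier G" "h \<in> carrier G"
  shows "commutator G g (inv h) \<in> N \<longleftrightarrow> commutator G g h \<in> N"
  using assms commutator_inv_left_iff commutator_swap_iff normal_imp_subgroup inv_closed by metis

text \<open>The Hall-Witt identity for the convention g h g^-1 h^-1, the group form of the Jacobi
  identity; it holds by free cancellation.\<close>

lemma hall_witt:
  assumes "x \<in> carrier G" "y \<in> carrier G" "z \<in> carrier G"
  shows "(y \<otimes> commutator G x (commutator G (inv y) z) \<otimes> inv y) \<otimes>
    ((z \<otimes> commutator G y (commutator G (inv z) x) \<otimes> inv z) \<otimes>
     (x \<otimes> commutator G z (commutator G (inv x) y) \<otimes> inv x)) = \<one>"
  using assms by (simp add: commutator_def m_assoc inv_mult_group)

text \<open>An elementwise three subgroups lemma: two of the three conjugated factors of the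
  Hall-Witt identity lie in N, hence so does the third.\<close>

lemma three_commutators:
  assumes N: "N \<lhd> G" and xyz: "x \<in> carrier G" "y \<in> carrier G" "z \<in> carrier G"
    and zxy: "commutator G (commutator G (inv z) x) y \<in> N"
    and xyz': "commutator G (commutator G (inv x) (inv y)) z \<in> N"
  shows "commutator G (commutator G y z) x \<in> N"
proof -
  have N': "subgroup N G"
    using N by (rule normal_imp_subgroup)
  let ?a = "inv y \<otimes> commutator G x (commutator G y z) \<otimes> inv (inv y)"
  let ?b = "z \<otimes> commutator G (inv y) (commutator G (inv z) x) \<otimes> inv z"
  let ?c = "x \<otimes> commutator G z (commutator G (inv x) (inv y)) \<otimes> inv x"
  \<comment> \<open>Taking \<open>inv y\<close> in place of \<open>y\<close> leaves the inner
    commutator of the conclusion free of inverses; they move into the two hypotheses.\<close>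
  have abc: "?a \<otimes> (?b \<otimes> ?c) = \<one>"
    using hall_witt[of x "inv y" z] xyz by simp
  have "commutator G (inv y) (commutator G (inv z) x) \<in> N"
    using zxy xyz N N' by (simp add: commutator_inv_left_iff commutator_swap_iff[of N y])
  then have "?b \<in> N"
    using N xyz by (simp add: normal_inv_op_iff)
  moreover have "commutator G z (commutator G (inv x) (inv y)) \<in> N"
    using xyz' xyz N' by (simp add: commutator_swap_iff[of N z])
  then have "?c \<in> N"
    using N xyz by (simp add: normal_inv_op_iff)
  ultimately have "inv (?b \<otimes> ?c) \<in> N"
    using N' by (meson subgroup.m_closed subgroup.m_inv_closed)
  moreover have "?a = inv (?b \<otimes> ?c)"
    by (rule sym, rule inv_equality[OF abc]) (use xyz in auto)
  ultimately have "commutator G x (commutator G y z) \<in> N"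
    using N xyz by (metis commutator_closed inv_closed normal_inv_op_iff)
  then show ?thesis
    using N' xyz by (simp add: commutator_swap_iff[of N x])
qed

section \<open>Commutator subgroups and the lower central series\<close>

lemma comm_subgroup_eq: "comm_subgroup G H K = generate G {commutator G h k |h k. h \<in> H \<and> k \<in> K}"
  unfolding comm_subgroup_def commutator_def
  by (rule arg_cong[of _ _ "generate G"]) auto

lemma commutator_in_comm_subgroup:
  "h \<in> H \<Longrightarrow> k \<in> K \<Longrightarrow> commutator G h k \<in> comm_subgroup G H K"
  unfolding comm_subgroup_eq by (rule generate.incl) auto

lemma comm_subgroup_least:
  "subgroup S G \<Longrightarrow> (\<And>h k. h \<in> H \<Longrightarrow> k \<in> K \<Longrightarrow> commutator G h k \<in> S) \<Longrightarrow> comm_subgroup G H K \<subseteq> S"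
  unfolding comm_subgroup_eq by (rule generate_subgroup_incl) auto

lemma comm_subgroup_normal:
  assumes "N \<lhd> G"
  shows "comm_subgroup G N (carrier G) \<lhd> G"
  unfolding comm_subgroup_eq
proof (rule normal_generateI)
  note N = normal_invE[OF assms]
  show "{commutator G h k |h k. h \<in> N \<and> k \<in> carrier G} \<subseteq> carrier G"
    using subgroup.subset[OF N(1)] by auto
  fix x g assume "x \<in> {commutator G h k |h k. h \<in> N \<and> k \<in> carrier G}" and g: "g \<in> carrier G"
  then obtain h k where hk: "x = commutator G h k" "h \<in> N" "k \<in> carrier G"
    by blast
  then have "g \<otimes> x \<otimes> inv g = commutator G (g \<otimes> h \<otimes> inv g) (g \<otimes> k \<otimes> inv g)"
    using g subgroup.subset[OF N(1)] by (auto simp: conj_commutator)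
  then show "g \<otimes> x \<otimes> inv g \<in> {commutator G h k |h k. h \<in> N \<and> k \<in> carrier G}"
    using hk g N(2) by blast
qed

lemma commutator_in_normal_left:
  assumes "N \<lhd> G" "h \<in> N" "k \<in> carrier G"
  shows "commutator G h k \<in> N"
proof -
  note N = normal_invE[OF assms(1)]
  have h: "h \<in> carrier G"
    using assms N subgroup.mem_carrier by metis
  have "h \<otimes> (k \<otimes> inv h \<otimes> inv k) \<in> N"
    using assms N subgroup.m_inv_closed[OF N(1)] subgroup.m_closed[OF N(1)] by blast
  then show ?thesis
    using h assms by (simp add: commutator_def m_assoc)
qed

lemma comm_subgroup_subset: "N \<lhd> G \<Longrightarrow> comm_subgroup G N (carrier G) \<subseteq> N"
  by (intro comm_subgroup_least normal_imp_subgroup commutator_in_normal_left)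

lemma iter_comm_normal: "N \<lhd> G \<Longrightarrow> iter_comm G N k \<lhd> G"
  by (induction k) (auto intro: comm_subgroup_normal)

lemma iter_comm_shift: "iter_comm G (comm_subgroup G N (carrier G)) k = iter_comm G N (Suc k)"
  by (induction k) auto

lemma iter_comm_subset: "N \<lhd> G \<Longrightarrow> iter_comm G N k \<subseteq> N"
  by (induction k) (use comm_subgroup_subset iter_comm_normal in fastforce)+

lemma carrier_normal: "carrier G \<lhd> G"
  by (rule normal_invI[OF subgroup_self]) auto

lemma lower_central_1: "lower_central G (Suc 0) = carrier G"
  by (simp add: lower_central_def)

lemma lower_central_Suc:
  "n \<ge> 1 \<Longrightarrow> lower_central G (Suc n) = comm_subgroup G (lower_central G n) (carrier G)"
  by (cases n) (auto simp: lower_central_def)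

lemma iter_comm_lower_central: "n \<ge> 1 \<Longrightarrow> iter_comm G (lower_central G n) k = lower_central G (n + k)"
  by (induction k) (auto simp: lower_central_Suc)

lemma lower_central_normal: "lower_central G n \<lhd> G"
  unfolding lower_central_def by (intro iter_comm_normal carrier_normal)

lemma lower_central_subgroup: "subgroup (lower_central G n) G"
  using lower_central_normal normal_imp_subgroup by blast

lemma lower_central_closed: "g \<in> lower_central G n \<Longrightarrow> g \<in> carrier G"
  using lower_central_subgroup subgroup.mem_carrier by metis

lemma lower_central_antimono:
  assumes "m \<le> n"
  shows "lower_central G n \<subseteq> lower_central G m"
  using assms
proof (induction n rule: dec_induct)
  case (step n)
  have "lower_central G (Suc n) \<subseteq> lower_central G n"
    using comm_subgroup_subset[OF lower_central_normal, of n]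
    by (cases n) (auto simp: lower_central_Suc, auto simp: lower_central_def)
  with step show ?case by simp
qed simp

text \<open>Induction on k, for all normal N simultaneously. For a generator [u, f] of gamma_{k+1},
  Hall-Witt reduces [[u, f], h] to [[f, h], u] and [[h, u], f], up to inverses. The first is covered
  by the induction hypothesis for [N, G], the second by that for N followed by one more
  commutator.\<close>

lemma commutator_in_iter_comm:
  assumes "k \<ge> 1" "N \<lhd> G" "h \<in> N" "g \<in> lower_central G k"
  shows "commutator G h g \<in> iter_comm G N k"
  using assms
proof (induction k arbitrary: N h g rule: nat_induct_at_least)
  case base
  then show ?case
    by (simp add: lower_central_1 commutator_in_comm_subgroup)
next
  case (Suc k)
  let ?T = "iter_comm G N (Suc k)" and ?N1 = "comm_subgroup G N (carrier G)"
  have T: "?T \<lhd> G" "subgroup ?T G" and N1: "?N1 \<lhd> G" "subgroup ?N1 G"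
    using Suc.prems(1) iter_comm_normal comm_subgroup_normal normal_imp_subgroup by blast+
  have h: "h \<in> carrier G" "inv h \<in> N"
    using Suc.prems normal_imp_subgroup subgroup.mem_carrier subgroup.m_inv_closed by metis+
  have "lower_central G (Suc k) \<subseteq> {g \<in> carrier G. commutator G g h \<in> ?T}"
    unfolding lower_central_Suc[OF Suc.hyps]
  proof (rule comm_subgroup_least[OF subgroup_commutator_left[OF T(1) h(1)]])
    fix u f assume u: "u \<in> lower_central G k" and f: "f \<in> carrier G"
    then have uc: "u \<in> carrier G"
      using lower_central_closed by blast
    have "commutator G (inv f) h \<in> ?N1"
      using Suc.prems f h by (simp add: commutator_swap_iff[OF N1(2), of _ h] commutator_in_comm_subgroup)
    then have "commutator G (commutator G (inv f) h) u \<in> iter_comm G ?N1 k"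
      \<comment> \<open>The induction hypothesis is applied to [N, G] instead of N.\<close>
      using u by (intro Suc.IH N1)
    then have 1: "commutator G (commutator G (inv f) h) u \<in> ?T"
      by (simp only: iter_comm_shift)
    have "commutator G (inv h) (inv u) \<in> iter_comm G N k"
      using u h Suc.prems by (intro Suc.IH) (auto intro: subgroup.m_inv_closed[OF lower_central_subgroup])
    then have 2: "commutator G (commutator G (inv h) (inv u)) f \<in> ?T"
      using f by (simp add: commutator_in_comm_subgroup)
    show "commutator G u f \<in> {g \<in> carrier G. commutator G g h \<in> ?T}"
      using three_commutators[OF T(1) h(1) uc f 1 2] uc f by simp
  qed
  then have "commutator G g h \<in> ?T"
    using Suc.prems by blast
  then show ?case
    using commutator_swap_iff[OF T(2) _ h(1)] lower_central_closed[OF Suc.prems(3)] by blast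
qed

lemma commutator_in_lower_central:
  assumes "i \<ge> 1" "j \<ge> 1" "g \<in> lower_central G i" "h \<in> lower_central G j"
  shows "commutator G g h \<in> lower_central G (i + j)"
  using commutator_in_iter_comm[OF assms(2) lower_central_normal assms(3,4)] assms(1)
  by (simp add: iter_comm_lower_central)

text \<open>The quotient gamma_n/gamma_{n+1} is central in G/gamma_{n+1}, and subgroups of the
  centre are normal.\<close>

lemma normal_between_lower_central:
  assumes "n \<ge> 1" "subgroup T G" "lower_central G (Suc n) \<subseteq> T" "T \<subseteq> lower_central G n"
  shows "T \<lhd> G"
proof (rule normal_invI[OF assms(2)])
  fix x h assume x: "x \<in> carrier G" and h: "h \<in> T"
  then have "commutator G h x \<in> lower_central G (Suc n)"
    using assms by (auto simp: lower_central_Suc intro: commutator_in_comm_subgroup)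
  with assms h have "inv (commutator G h x) \<otimes> h \<in> T"
    by (meson subgroup.m_closed subgroup.m_inv_closed subsetD)
  then show "x \<otimes> h \<otimes> inv x \<in> T"
    using x h assms(2) by (simp add: conj_eq_commutator subgroup.mem_carrier)
qed

end

section \<open>Generation of the lower central quotients by basic commutators\<close>

primrec bracket_eval :: "('a, 'm) monoid_scheme \<Rightarrow> (nat \<Rightarrow> 'a) \<Rightarrow> nat bracket \<Rightarrow> 'a" where
  "bracket_eval G \<xi> (Letter i) = \<xi> i"
| "bracket_eval G \<xi> (Br u v) = commutator G (bracket_eval G \<xi> u) (bracket_eval G \<xi> v)"

lemma basicsD:
  assumes "b \<in> basics q n"
  shows "basic b" "set_bracket b \<subseteq> {..<q}" "weight b = n"
  using assms by (auto simp: basics_def)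

locale generated_group = group G for G (structure) +
  fixes \<xi> :: "nat \<Rightarrow> 'a" and q :: nat
  assumes gens_closed: "\<xi> ` {..<q} \<subseteq> carrier G"
    and generates: "generate G (\<xi> ` {..<q}) = carrier G"
begin

abbreviation "ev \<equiv> bracket_eval G \<xi>"

text \<open>The next term of the lower central series is adjoined so that membership expresses
  generation modulo that term.\<close>

definition basic_span :: "nat \<Rightarrow> 'a set" where
  "basic_span n = generate G (ev ` basics q n \<union> lower_central G (Suc n))"

lemma eval_in_lower_central:
  "set_bracket b \<subseteq> {..<q} \<Longrightarrow> ev b \<in> lower_central G (weight b)"
proof (induction b)
  case (Letter i)
  then show ?case
    using gens_closed by (auto simp: lower_central_1)
next
  case (Br u v)
  have "weight u \<ge> 1" "weight v \<ge> 1"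
    using weight_pos[of u] weight_pos[of v] by linarith+
  with Br show ?case
    by (auto intro: commutator_in_lower_central)
qed

lemma eval_closed: "set_bracket b \<subseteq> {..<q} \<Longrightarrow> ev b \<in> carrier G"
  using eval_in_lower_central lower_central_closed by blast

lemma basic_span_gens: "ev ` basics q n \<union> lower_central G (Suc n) \<subseteq> carrier G"
  using eval_closed lower_central_closed basicsD(2) by blast

lemma basic_span_subgroup: "subgroup (basic_span n) G"
  unfolding basic_span_def by (intro generate_is_subgroup basic_span_gens)

lemma lower_central_subset_basic_span: "lower_central G (Suc n) \<subseteq> basic_span n"
  unfolding basic_span_def by (auto intro: generate.incl)

lemma eval_in_basic_span: "b \<in> basics q n \<Longrightarrow> ev b \<in> basic_span n"
  unfolding basic_span_def by (auto intro: generate.incl)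

lemma basic_span_subset:
  assumes "subgroup T G" "lower_central G (Suc n) \<subseteq> T" "\<And>b. b \<in> basics q n \<Longrightarrow> ev b \<in> T"
  shows "basic_span n \<subseteq> T"
  unfolding basic_span_def by (rule generate_subgroup_incl) (use assms in auto)

lemma basic_span_subset_lower_central: "basic_span n \<subseteq> lower_central G n"
proof (intro basic_span_subset lower_central_subgroup lower_central_antimono)
  fix b assume "b \<in> basics q n"
  from eval_in_lower_central[OF basicsD(2)[OF this]] basicsD(3)[OF this]
  show "ev b \<in> lower_central G n" by simp
qed simp

lemma basic_span_normal: "n \<ge> 1 \<Longrightarrow> basic_span n \<lhd> G"
  using basic_span_subgroup lower_central_subset_basic_span basic_span_subset_lower_central
  by (intro normal_between_lower_central)

text \<open>The rewriting step is the Jacobi identity \<open>[[u1, u2], v] = [[u1, v], u2] + [u1, [u2, v]]\<close> for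
  \<open>u1 > u2 > v\<close>: in both terms on the right the smaller of the two factors has grown beyond \<open>v\<close>.\<close>

lemma commutator_eval_in_basic_span:
  assumes "u \<in> basics q i" "v \<in> basics q j"
  shows "commutator G (ev u) (ev v) \<in> basic_span (i + j)"
  using assms
proof (induction "i + j" arbitrary: i j u v rule: less_induct)
  case (less i j u v)
  define n where "n = i + j"
  \<comment> \<open>A finite set containing every basic commutator that can occur as a factor in
    total weight \<open>n\<close>. It makes the number of brackets above \<open>v\<close> a
    decreasing measure when the smaller factor grows.\<close>
  define fin where "fin = (\<Union>m\<le>n. basics q m)"
  have finfin: "finite fin"
    unfolding fin_def by (simp add: finite_basics)
  have pos: "m \<ge> 1" if "w \<in> basics q m" for w m
    using basicsD(3)[OF that] weight_pos[of w] by simp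
  have n1: "n \<ge> 1"
    using pos[OF less.prems(1)] by (simp add: n_def)
  note S = basic_span_normal[OF n1] basic_span_subgroup[of n]
  \<comment> \<open>For fixed total weight there is an inner induction on how many brackets exceed
    the smaller factor \<open>v\<close>, inside the outer induction on the total weight.\<close>
  have "\<forall>i j u. u \<in> basics q i \<longrightarrow> v \<in> basics q j \<longrightarrow> i + j = n \<longrightarrow> bracket_less v u \<longrightarrow>
      commutator G (ev u) (ev v) \<in> basic_span n" for v
  proof (induction "card {b \<in> fin. bracket_less v b}" arbitrary: v rule: less_induct)
    case inner: (less v)
    show ?case
    proof (intro allI impI)
      fix i j u
      assume u: "u \<in> basics q i" and v: "v \<in> basics q j" and ij: "i + j = n" and vu: "bracket_less v u"
      \<comment> \<open>If both factors exceed \<open>v\<close>, so does the smaller one, and the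
        inner induction applies. The order of the factors is immaterial because swapping them
        inverts the commutator.\<close>
      have bigger: "commutator G (ev p) (ev p') \<in> basic_span n"
        if p: "p \<in> basics q k" "p' \<in> basics q l" "k + l = n" "bracket_less v p" "bracket_less v p'" for p p' k l
      proof -
        have IH: "commutator G (ev p) (ev p') \<in> basic_span n"
          if p: "p \<in> basics q k" "p' \<in> basics q l" "k + l = n" "bracket_less v p'" "bracket_less p' p" for p p' k l
        proof -
          have "p' \<in> fin"
            using p by (auto simp: fin_def)
          then have "{b \<in> fin. bracket_less p' b} \<subset> {b \<in> fin. bracket_less v b}"
            using p(4) bracket_less_trans by (auto intro!: psubsetI) (metis (no_types, lifting) bracket_less_irrefl mem_Collect_eq)
          then have "card {b \<in> fin. bracket_less p' b} < card {b \<in> fin. bracket_less v b}"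
            using finfin by (intro psubset_card_mono) auto
          with inner p show ?thesis by blast
        qed
        have c: "ev p \<in> carrier G" "ev p' \<in> carrier G"
          using p eval_closed basicsD(2) by blast+
        consider "bracket_less p' p" | "p = p'" | "bracket_less p p'"
          using bracket_less_total by blast
        then show ?thesis
        proof cases
          case 1 then show ?thesis using IH p by blast
        next
          case 2 then show ?thesis using c S(2) by (simp add: subgroup.one_closed)
        next
          case 3
          then have "commutator G (ev p') (ev p) \<in> basic_span n"
            using IH[of p' l p k] p by (simp add: add.commute)
          then show ?thesis
            using c S(2) commutator_swap_iff by blast
        qed
      qed
      show "commutator G (ev u) (ev v) \<in> basic_span n"
      proof (cases "fits u [v]")
        case True
        then have "Br u v \<in> basics q n"
          using u v vu ij by (auto simp: basics_def basic_Br)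
        from eval_in_basic_span[OF this] show ?thesis by simp
      next
        case False
        then obtain u1 u2 where u12: "u = Br u1 u2" and v2: "bracket_less v u2"
          by (cases u) auto
        define a b where "a = weight u1" and "b = weight u2"
        have ui: "u1 \<in> basics q a" "u2 \<in> basics q b" "bracket_less u2 u1" "i = a + b"
          using u by (auto simp: u12 a_def b_def basics_def basic_Br)
        have ab: "a \<ge> 1" "b \<ge> 1" "j \<ge> 1"
          using pos ui(1,2) v by auto
        have v1: "bracket_less v u1"
          using v2 ui(3) by (rule bracket_less_trans)
        have c: "ev u1 \<in> carrier G" "ev u2 \<in> carrier G" "ev v \<in> carrier G"
          using ui v eval_closed basicsD(2) by blast+
        \<comment> \<open>Both Jacobi terms have the shape [[p', v], p] up to inverses, which
          \<open>xy\<close> absorbs by speaking of membership in normal subgroups. The outer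
          induction writes [p', v] in basic commutators \<open>h\<close> of greater weight than
          \<open>v\<close>, and \<open>bigger\<close> treats each [h, p].\<close>
        have step: "commutator G (commutator G x y) (ev p) \<in> basic_span n"
          if p: "p \<in> basics q k" "bracket_less v p"
            and p': "p' \<in> basics q l" and sum: "k + l + j = n"
            and xy: "\<And>T. T \<lhd> G \<Longrightarrow> commutator G (ev p') (ev v) \<in> T \<Longrightarrow> commutator G x y \<in> T" for p p' k l x y
        proof -
          have kl: "k \<ge> 1" "l \<ge> 1"
            using p p' pos by auto
          \<comment> \<open>Intersecting with gamma_{l+j} places \<open>T\<close> between two
            consecutive terms, which makes it normal, so that \<open>xy\<close> can be applied to
            it.\<close>
          define T where "T = lower_central G (l + j) \<inter> {g \<in> carrier G. commutator G g (ev p) \<in> basic_span n}"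
          have pc: "ev p \<in> lower_central G k"
            using eval_in_lower_central[of p] basicsD[OF p(1)] by simp
          have sub: "subgroup T G"
            unfolding T_def
            by (intro subgroups_Inter_pair lower_central_subgroup subgroup_commutator_left S(1)
                lower_central_closed[OF pc])
          have low: "lower_central G (Suc (l + j)) \<subseteq> T"
          proof
            fix g assume g: "g \<in> lower_central G (Suc (l + j))"
            then have "commutator G g (ev p) \<in> lower_central G (Suc (l + j) + k)"
              using pc kl by (intro commutator_in_lower_central) auto
            then have "commutator G g (ev p) \<in> basic_span n"
              using lower_central_subset_basic_span[of n] sum by (auto simp: add_ac)
            then show "g \<in> T"
              using g lower_central_closed lower_central_antimono[of "l + j" "Suc (l + j)"]
              by (auto simp: T_def)
          qed
          have T: "T \<lhd> G"
            using kl sub low by (intro normal_between_lower_central[of "l + j"]) (auto simp: T_def)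
          have "basic_span (l + j) \<subseteq> T"
          proof (rule basic_span_subset[OF sub low])
            fix h assume h: "h \<in> basics q (l + j)"
            then have "weight v < weight h"
              using kl basicsD(3)[OF v] basicsD(3)[OF h] by simp
            then have "commutator G (ev h) (ev p) \<in> basic_span n"
              using h p sum by (intro bigger[of h "l + j" p k]) (auto simp: bracket_less_weight)
            then show "ev h \<in> T"
              using h eval_in_lower_central[of h] basicsD[OF h] eval_closed by (auto simp: T_def)
          qed
          moreover have "commutator G (ev p') (ev v) \<in> basic_span (l + j)"
            using p' v kl sum n_def by (intro less.hyps) auto
          ultimately have "commutator G x y \<in> T"
            using xy[OF T] by blast
          then show ?thesis
            by (simp add: T_def)
        qed
        have 1: "commutator G (commutator G (inv (ev u2)) (ev v)) (ev u1) \<in> basic_span n"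
          by (rule step[OF ui(1) v1 ui(2)]) (use ui ij c in \<open>auto simp: commutator_inv_left_iff\<close>)
        have 2: "commutator G (commutator G (inv (ev v)) (inv (ev u1))) (ev u2) \<in> basic_span n"
          by (rule step[OF ui(2) v2 ui(1)])
            (use ui ij c in \<open>auto simp: commutator_inv_left_iff commutator_inv_right_iff
              commutator_swap_iff[OF normal_imp_subgroup, of _ "ev v"]\<close>)
        show ?thesis
          using three_commutators[OF S(1) c(3,1,2) 1 2] by (simp add: u12)
      qed
    qed
  qed
  then have gt: "commutator G (ev u) (ev v) \<in> basic_span n"
    if "u \<in> basics q i" "v \<in> basics q j" "i + j = n" "bracket_less v u" for u v i j
    using that by blast
  have c: "ev u \<in> carrier G" "ev v \<in> carrier G"
    using less.prems eval_closed basicsD(2) by blast+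
  consider "bracket_less v u" | "u = v" | "bracket_less u v"
    using bracket_less_total by blast
  then show ?case
  proof cases
    case 1 then show ?thesis using gt less.prems n_def by blast
  next
    case 2 then show ?thesis using c basic_span_subgroup by (simp add: subgroup.one_closed)
  next
    case 3
    then have "commutator G (ev v) (ev u) \<in> basic_span n"
      using gt[of v j u i] less.prems n_def by (simp add: add.commute)
    then show ?thesis
      using c S(2) commutator_swap_iff n_def by blast
  qed
qed

lemma Letter_in_basics: "i < q \<Longrightarrow> Letter i \<in> basics q 1"
  by (auto simp: basics_def)

text \<open>In the induction a generator [g, f] of gamma_{n+1} is reduced in both arguments: g to a
  basic commutator of weight n, f to a letter. What remains is a commutator of two basic
  ones.\<close>

theorem lower_central_eq_basic_span:
  assumes "n \<ge> 1"
  shows "lower_central G n = basic_span n"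
proof (rule equalityI)
  show "lower_central G n \<subseteq> basic_span n"
    using assms
  proof (induction n rule: nat_induct_at_least)
    case base
    have "generate G (\<xi> ` {..<q}) \<subseteq> basic_span 1"
      using eval_in_basic_span[OF Letter_in_basics]
      by (intro generate_subgroup_incl basic_span_subgroup) auto
    then show ?case
      using generates by (simp add: lower_central_1)
  next
    case (Suc n)
    note S = basic_span_normal[of "Suc n"] basic_span_subgroup[of "Suc n"]
    show ?case
      unfolding lower_central_Suc[OF Suc.hyps]
    proof (rule comm_subgroup_least[OF S(2)])
      fix g f assume g: "g \<in> lower_central G n" and f: "f \<in> carrier G"
      have "basic_span n \<subseteq> {g \<in> carrier G. commutator G g f \<in> basic_span (Suc n)}"
      proof (rule basic_span_subset)
        show "subgroup {g \<in> carrier G. commutator G g f \<in> basic_span (Suc n)} G"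
          using S f by (intro subgroup_commutator_left) auto
        show "lower_central G (Suc n) \<subseteq> {g \<in> carrier G. commutator G g f \<in> basic_span (Suc n)}"
        proof
          fix g assume g: "g \<in> lower_central G (Suc n)"
          then have "commutator G g f \<in> lower_central G (Suc (Suc n))"
            using f by (simp add: lower_central_Suc[of "Suc n"] commutator_in_comm_subgroup)
          then show "g \<in> {g \<in> carrier G. commutator G g f \<in> basic_span (Suc n)}"
            using g lower_central_closed lower_central_subset_basic_span by blast
        qed
      next
        fix b assume b: "b \<in> basics q n"
        have bc: "ev b \<in> carrier G"
          using b eval_closed basicsD(2) by blast
        have "generate G (\<xi> ` {..<q}) \<subseteq> {f \<in> carrier G. commutator G f (ev b) \<in> basic_span (Suc n)}"
        proof (rule generate_subgroup_incl)
          show "subgroup {f \<in> carrier G. commutator G f (ev b) \<in> basic_span (Suc n)} G"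
            using S bc by (intro subgroup_commutator_left) auto
          show "\<xi> ` {..<q} \<subseteq> {f \<in> carrier G. commutator G f (ev b) \<in> basic_span (Suc n)}"
            using gens_closed commutator_eval_in_basic_span[OF Letter_in_basics b] by auto
        qed
        then have "commutator G f (ev b) \<in> basic_span (Suc n)"
          using f generates by blast
        then show "ev b \<in> {g \<in> carrier G. commutator G g f \<in> basic_span (Suc n)}"
          using bc f S(2) commutator_swap_iff by blast
      qed
      then show "commutator G g f \<in> basic_span (Suc n)"
        using g Suc.IH by blast
    qed
  qed
qed (rule basic_span_subset_lower_central)

end

section \<open>Free groups\<close>

lemma inv_letter_inv_letter [simp]: "inv_letter (inv_letter l) = l"
  by (simp add: inv_letter_def)

lemma fst_inv_letter [simp]: "fst (inv_letter l) = fst l"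
  by (simp add: inv_letter_def)

lemma reduced_Nil [simp]: "reduced []"
  by (simp add: reduced_def)

lemma reduced_Cons: "reduced (l # w) \<longleftrightarrow> reduced w \<and> (w = [] \<or> hd w \<noteq> inv_letter l)"
  by (auto simp: reduced_def successively_Cons)

lemma reduced_push: "reduced w \<Longrightarrow> reduced (push l w)"
  by (cases w) (auto simp: reduced_Cons)

lemma push_reduced: "reduced (l # w) \<Longrightarrow> push l w = l # w"
  by (cases w) (auto simp: reduced_Cons)

lemma push_push_inv_letter: "reduced w \<Longrightarrow> push l (push (inv_letter l) w) = w"
  by (cases w) (auto simp: reduced_Cons push_reduced)

lemma reduced_foldr_push: "reduced v \<Longrightarrow> reduced (foldr push u v)"
  by (induction u) (auto simp: reduced_push)

lemma set_push: "set (push l w) \<subseteq> insert l (set w)"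
  by (cases w) auto

lemma set_foldr_push: "set (foldr push u v) \<subseteq> set u \<union> set v"
  by (induction u) (use set_push in fastforce)+

lemma foldr_push_push:
  "reduced w \<Longrightarrow> foldr push (push l v) w = push l (foldr push v w)"
  by (cases v) (auto simp: push_push_inv_letter reduced_foldr_push)

lemma foldr_push_assoc:
  "reduced w \<Longrightarrow> foldr push (foldr push u v) w = foldr push u (foldr push v w)"
  by (induction u) (auto simp: foldr_push_push)

lemma foldr_push_inverse:
  "reduced w \<Longrightarrow> foldr push (rev (map inv_letter w)) w = []"
  by (induction w) (auto simp: reduced_Cons)

lemma reduced_inverse: "reduced w \<Longrightarrow> reduced (rev (map inv_letter w))"
  by (auto simp: reduced_def successively_rev successively_map elim!: successively_mono)

lemma carrier_free_group: "w \<in> carrier (free_group A) \<longleftrightarrow> reduced w \<and> fst ` set w \<subseteq> A"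
  by (simp add: free_group_def)

lemma mult_free_group [simp]: "u \<otimes>\<^bsub>free_group A\<^esub> v = foldr push u v"
  by (simp add: free_group_def)

lemma one_free_group [simp]: "\<one>\<^bsub>free_group A\<^esub> = []"
  by (simp add: free_group_def)

lemma group_free_group: "group (free_group A)"
proof (rule groupI)
  fix u v assume "u \<in> carrier (free_group A)" "v \<in> carrier (free_group A)"
  then show "u \<otimes>\<^bsub>free_group A\<^esub> v \<in> carrier (free_group A)"
    using set_foldr_push[of u v] by (fastforce simp: carrier_free_group reduced_foldr_push)
next
  fix w assume "w \<in> carrier (free_group A)"
  then have "rev (map inv_letter w) \<in> carrier (free_group A)"
    by (auto simp: carrier_free_group reduced_inverse)
  moreover have "rev (map inv_letter w) \<otimes>\<^bsub>free_group A\<^esub> w = \<one>\<^bsub>free_group A\<^esub>"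
    using \<open>w \<in> _\<close> by (simp add: carrier_free_group foldr_push_inverse)
  ultimately show "\<exists>v\<in>carrier (free_group A). v \<otimes>\<^bsub>free_group A\<^esub> w = \<one>\<^bsub>free_group A\<^esub>"
    by blast
qed (auto simp: carrier_free_group foldr_push_assoc)

lemma free_gen_closed: "a \<in> A \<Longrightarrow> free_gen a \<in> carrier (free_group A)"
  by (simp add: carrier_free_group free_gen_def reduced_Cons)

lemma inv_free_gen: "a \<in> A \<Longrightarrow> inv\<^bsub>free_group A\<^esub> (free_gen a) = [(a, False)]"
  by (rule group.inv_equality[OF group_free_group])
     (auto simp: carrier_free_group free_gen_def reduced_Cons inv_letter_def)

lemma Cons_free_group:
  assumes "l # w \<in> carrier (free_group A)"
  shows "l # w = [l] \<otimes>\<^bsub>free_group A\<^esub> w" "w \<in> carrier (free_group A)"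
    "[l] = (if snd l then free_gen (fst l) else inv\<^bsub>free_group A\<^esub> (free_gen (fst l)))" "fst l \<in> A"
  using assms by (auto simp: carrier_free_group push_reduced reduced_Cons free_gen_def inv_free_gen[unfolded free_gen_def])
    (metis prod.collapse)+

lemma generate_free_group: "generate (free_group A) (free_gen ` A) = carrier (free_group A)"
proof
  interpret group "free_group A"
    by (rule group_free_group)
  show "generate (free_group A) (free_gen ` A) \<subseteq> carrier (free_group A)"
    by (rule generate_incl) (auto intro: free_gen_closed)
  have "w \<in> generate (free_group A) (free_gen ` A)" if "w \<in> carrier (free_group A)" for w
    using that
  proof (induction w)
    case Nil
    then show ?case
      using generate.one[of "free_group A"] by simp
  next
    case (Cons l w)
    note Cons_free_group[OF Cons.prems]
    moreover from this have "[l] \<in> generate (free_group A) (free_gen ` A)"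
      by (auto intro: generate.incl generate.inv)
    ultimately show ?case
      using Cons.IH generate.eng by metis
  qed
  then show "carrier (free_group A) \<subseteq> generate (free_group A) (free_gen ` A)"
    by blast
qed

section \<open>The universal property and projectivity of free groups\<close>

definition word_eval :: "('b, 'm) monoid_scheme \<Rightarrow> ('a \<Rightarrow> 'b) \<Rightarrow> 'a word \<Rightarrow> 'b" where
  "word_eval G \<phi> w =
     foldr (\<lambda>l g. (if snd l then \<phi> (fst l) else inv\<^bsub>G\<^esub> (\<phi> (fst l))) \<otimes>\<^bsub>G\<^esub> g) w \<one>\<^bsub>G\<^esub>"

context group
begin

lemma word_eval_simps:
  "word_eval G \<phi> [] = \<one>"
  "word_eval G \<phi> (l # w) = (if snd l then \<phi> (fst l) else inv (\<phi> (fst l))) \<otimes> word_eval G \<phi> w"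
  by (simp_all add: word_eval_def)

lemma word_eval_closed:
  "\<phi> ` A \<subseteq> carrier G \<Longrightarrow> fst ` set w \<subseteq> A \<Longrightarrow> word_eval G \<phi> w \<in> carrier G"
  by (induction w) (auto simp: word_eval_simps)

lemma word_eval_push:
  assumes "\<phi> ` A \<subseteq> carrier G" "fst ` set w \<subseteq> A" "fst l \<in> A"
  shows "word_eval G \<phi> (push l w) = word_eval G \<phi> [l] \<otimes> word_eval G \<phi> w"
proof (cases w)
  case Nil
  then show ?thesis
    using assms by (auto simp: word_eval_simps)
next
  case (Cons l' w')
  have "word_eval G \<phi> w' \<in> carrier G" "\<phi> (fst l) \<in> carrier G"
    using assms Cons word_eval_closed[of \<phi> A w'] by auto
  then show ?thesis
    using assms by (auto simp: Cons word_eval_simps inv_letter_def)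
qed

lemma word_eval_hom:
  assumes "\<phi> ` A \<subseteq> carrier G"
  shows "word_eval G \<phi> \<in> hom (free_group A) G"
proof (rule homI)
  fix u v assume "u \<in> carrier (free_group A)" and v: "v \<in> carrier (free_group A)"
  then have "fst ` set u \<subseteq> A"
    by (simp add: carrier_free_group)
  then show "word_eval G \<phi> (u \<otimes>\<^bsub>free_group A\<^esub> v) = word_eval G \<phi> u \<otimes> word_eval G \<phi> v"
  proof (induction u)
    case Nil
    then show ?case
      using v assms by (simp add: word_eval_simps word_eval_closed carrier_free_group)
  next
    case (Cons l u)
    have "fst ` set (foldr push u v) \<subseteq> A"
      using Cons.prems v set_foldr_push[of u v] by (fastforce simp: carrier_free_group)
    moreover have "word_eval G \<phi> u \<in> carrier G" "word_eval G \<phi> v \<in> carrier G" "\<phi> (fst l) \<in> carrier G"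
      using assms Cons.prems v by (auto simp: carrier_free_group intro!: word_eval_closed[OF assms])
    ultimately show ?case
      using Cons assms by (simp add: word_eval_push[of \<phi> A] m_assoc word_eval_simps)
  qed
qed (rule word_eval_closed[OF assms], simp add: carrier_free_group)

lemma word_eval_free_gen: "\<phi> a \<in> carrier G \<Longrightarrow> word_eval G \<phi> (free_gen a) = \<phi> a"
  by (simp add: word_eval_simps free_gen_def)

end

lemma hom_free_group_eq:
  assumes "group G" "h \<in> hom (free_group A) G" "h' \<in> hom (free_group A) G"
    and gen: "\<And>a. a \<in> A \<Longrightarrow> h (free_gen a) = h' (free_gen a)"
    and w: "w \<in> carrier (free_group A)"
  shows "h w = h' w"
proof -
  interpret h: group_hom "free_group A" G h
    using assms group_free_group by (simp add: group_hom_def group_hom_axioms_def)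
  interpret h': group_hom "free_group A" G h'
    using assms group_free_group by (simp add: group_hom_def group_hom_axioms_def)
  have "w \<in> generate (free_group A) (free_gen ` A)"
    using w by (simp add: generate_free_group)
  then show ?thesis
  proof induction
    case (eng v w)
    then have "v \<in> carrier (free_group A)" "w \<in> carrier (free_group A)"
      by (simp_all add: generate_free_group)
    with eng show ?case
      by (simp del: mult_free_group)
  qed (auto simp: gen free_gen_closed simp del: one_free_group)
qed

text \<open>Free groups are projective: any choice of preimages for the images of the free
  generators extends to a homomorphism.\<close>

lemma free_group_lift:
  assumes "group G" "group H" "\<pi> \<in> hom (free_group A) G" "\<rho> \<in> epi H G"
  obtains f where "f \<in> hom (free_group A) H" "\<And>w. w \<in> carrier (free_group A) \<Longrightarrow> \<rho> (f w) = \<pi> w"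
proof -
  have "\<exists>h\<in>carrier H. \<rho> h = \<pi> (free_gen a)" if "a \<in> A" for a
  proof -
    have "\<pi> (free_gen a) \<in> \<rho> ` carrier H"
      using assms free_gen_closed[OF that] by (auto simp: epi_def hom_def)
    then show ?thesis by force
  qed
  then obtain \<phi> where \<phi>: "\<And>a. a \<in> A \<Longrightarrow> \<phi> a \<in> carrier H \<and> \<rho> (\<phi> a) = \<pi> (free_gen a)"
    by metis
  have f: "word_eval H \<phi> \<in> hom (free_group A) H"
    using assms(2) \<phi> by (intro group.word_eval_hom) auto
  moreover have "\<rho> (word_eval H \<phi> w) = \<pi> w" if "w \<in> carrier (free_group A)" for w
  proof -
    have "(\<rho> \<circ> word_eval H \<phi>) w = \<pi> w"
    proof (rule hom_free_group_eq[OF assms(1) _ assms(3) _ that])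
      show "\<rho> \<circ> word_eval H \<phi> \<in> hom (free_group A) G"
        using assms(4) by (auto simp: epi_def intro: hom_compose[OF f])
      fix a assume "a \<in> A"
      then show "(\<rho> \<circ> word_eval H \<phi>) (free_gen a) = \<pi> (free_gen a)"
        using \<phi> assms(2) by (simp add: group.word_eval_free_gen)
    qed
    then show ?thesis by simp
  qed
  ultimately show thesis
    using that by blast
qed

lemma is_free_group_lift:
  fixes F :: "('a, 'm) monoid_scheme"
  assumes "is_free_group F" "group G" "group H" "\<pi> \<in> hom F G" "\<rho> \<in> epi H G"
  obtains f where "f \<in> hom F H" "\<And>w. w \<in> carrier F \<Longrightarrow> \<rho> (f w) = \<pi> w"
proof -
  obtain A :: "'a set" and i where F: "group F" and i: "i \<in> iso F (free_group A)"
    using assms(1) by (auto simp: is_free_group_def is_iso_def)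
  define j where "j = inv_into (carrier F) i"
  have j: "j \<in> hom (free_group A) F"
    using group.iso_set_sym[OF F i] by (simp add: j_def iso_def)
  have ji: "j (i w) = w" if "w \<in> carrier F" for w
    using i that by (auto simp: j_def iso_def bij_betw_def)
  obtain f where f: "f \<in> hom (free_group A) H" "\<And>w. w \<in> carrier (free_group A) \<Longrightarrow> \<rho> (f w) = (\<pi> \<circ> j) w"
    using free_group_lift[OF assms(2,3) hom_compose[OF j assms(4)] assms(5)] by blast
  have ih: "i \<in> hom F (free_group A)"
    using i by (simp add: iso_def)
  show thesis
  proof
    show "f \<circ> i \<in> hom F H"
      using ih f(1) by (rule hom_compose)
    show "\<rho> ((f \<circ> i) w) = \<pi> w" if "w \<in> carrier F" for w
      using f(2)[of "i w"] ji[OF that] that ih by (auto simp: hom_def)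
  qed
qed

section \<open>Independence of the Baer invariant from the presentation\<close>

lemma (in group) group_hom_FactGroup:
  "N \<lhd> G \<Longrightarrow> group_hom G (G Mod N) (\<lambda>a. N #> a)"
  by (simp add: group_hom_def group_hom_axioms_def normal.factorgroup_is_group normal.r_coset_hom_Mod)

lemma (in group) rcos_eq_iff:
  assumes "subgroup N G" "a \<in> carrier G" "b \<in> carrier G"
  shows "N #> a = N #> b \<longleftrightarrow> a \<otimes> inv b \<in> N"
proof -
  have "N #> a = N #> b \<longleftrightarrow> a \<in> N #> b"
    using assms repr_independence[of a N b] rcos_self[of a N] by auto
  then show ?thesis
    using assms subgroup.rcos_module[OF assms(1) is_group assms(3,2)] by simp
qed

lemma (in group) kernel_FactGroup:
  assumes "N \<lhd> G"
  shows "kernel G (G Mod N) (\<lambda>a. N #> a) = N"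
proof -
  note N = normal_imp_subgroup[OF assms]
  have "N #> a = N \<longleftrightarrow> a \<in> N" if "a \<in> carrier G" for a
    using N that coset_join1 coset_join2 by metis
  then have "kernel G (G Mod N) (\<lambda>a. N #> a) = {a \<in> carrier G. a \<in> N}"
    by (auto simp only: kernel_def one_FactGroup)
  then show ?thesis
    using subgroup.subset[OF N] by auto
qed

lemma (in group_hom) hom_commutator:
  "g \<in> carrier G \<Longrightarrow> h' \<in> carrier G \<Longrightarrow> h (commutator G g h') = commutator H (h g) (h h')"
  by (simp add: commutator_def)

lemma (in group_hom) hom_comm_subgroup:
  assumes "K \<subseteq> carrier G" "L \<subseteq> carrier G" "h ` K \<subseteq> K'" "h ` L \<subseteq> L'"
  shows "h ` comm_subgroup G K L \<subseteq> comm_subgroup H K' L'"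
proof -
  let ?S = "{commutator G x y |x y. x \<in> K \<and> y \<in> L}"
  have "h ` ?S \<subseteq> {commutator H x y |x y. x \<in> K' \<and> y \<in> L'}"
  proof clarify
    fix x y assume "x \<in> K" "y \<in> L"
    then have "h (commutator G x y) = commutator H (h x) (h y)" "h x \<in> K'" "h y \<in> L'"
      using assms by (auto simp: hom_commutator subset_iff)
    then show "\<exists>x' y'. h (commutator G x y) = commutator H x' y' \<and> x' \<in> K' \<and> y' \<in> L'"
      by blast
  qed
  from H.mono_generate[OF this]
  have "generate H (h ` ?S) \<subseteq> comm_subgroup H K' L'"
    by (simp only: H.comm_subgroup_eq)
  moreover have "?S \<subseteq> carrier G"
    using assms(1,2) by (blast intro: G.commutator_closed)
  ultimately show ?thesis
    by (simp only: G.comm_subgroup_eq generate_img)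
qed

lemma (in group_hom) hom_iter_comm:
  assumes "N \<lhd> G" "h ` N \<subseteq> N'"
  shows "h ` iter_comm G N k \<subseteq> iter_comm H N' k"
proof (induction k)
  case (Suc k)
  have "iter_comm G N k \<subseteq> carrier G"
    using subgroup.subset[OF normal_imp_subgroup[OF G.iter_comm_normal[OF assms(1)]]] .
  moreover have "h ` carrier G \<subseteq> carrier H"
    by auto
  ultimately show ?case
    using hom_comm_subgroup[OF _ subset_refl Suc] by simp
qed (use assms in simp)

lemma (in group_hom) hom_lower_central: "h ` lower_central G n \<subseteq> lower_central H n"
  unfolding lower_central_def by (rule hom_iter_comm[OF G.carrier_normal]) auto

lemma (in group) iter_comm_mono:
  "K \<subseteq> L \<Longrightarrow> iter_comm G K k \<subseteq> iter_comm G L k"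
proof (induction k)
  case (Suc k)
  then have "iter_comm G K k \<subseteq> iter_comm G L k" by blast
  then show ?case
    by (auto simp: comm_subgroup_eq intro!: mono_generate subsetD[OF mono_generate])
qed simp

lemma (in group) iter_comm_subset_lower_central:
  "N \<lhd> G \<Longrightarrow> iter_comm G N k \<subseteq> lower_central G (k + 1)"
  unfolding lower_central_def using iter_comm_mono[of N "carrier G"] normal_imp_subgroup subgroup.subset
  by fastforce

text \<open>Meant for a quotient in which the correction \<open>a\<close> is central and the
  correction \<open>v\<close> commutes with everything it has to pass: the commutator of the
  corrected elements is then unchanged.\<close>

lemma (in group) commutator_mult_commuting:
  assumes "a \<in> carrier G" "b \<in> carrier G" "v \<in> carrier G" "f \<in> carrier G"
    and a: "\<And>g. g \<in> carrier G \<Longrightarrow> commutator G a g = \<one>"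
    and vb: "commutator G v b = \<one>" and vbf: "commutator G v (commutator G b f) = \<one>"
  shows "commutator G (a \<otimes> b) (v \<otimes> f) = commutator G b f"
proof -
  have comm: "x \<otimes> y = y \<otimes> x" if "commutator G x y = \<one>" "x \<in> carrier G" "y \<in> carrier G" for x y
  proof -
    have "x \<otimes> y = commutator G x y \<otimes> (y \<otimes> x)"
      using that(2,3) by (simp add: commutator_def m_assoc)
    then show ?thesis
      using that by simp
  qed
  have "commutator G (a \<otimes> b) (v \<otimes> f) =
      a \<otimes> commutator G b (v \<otimes> f) \<otimes> inv a \<otimes> commutator G a (v \<otimes> f)"
    using assms(1-4) by (simp add: commutator_mult_left)
  also have "\<dots> = commutator G b (v \<otimes> f)"
    using assms(1-4) a[of "v \<otimes> f"] comm[OF a, of "commutator G b (v \<otimes> f)"] by (simp add: m_assoc)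
  also have "\<dots> = b \<otimes> v \<otimes> f \<otimes> inv b \<otimes> inv f \<otimes> inv v"
    using assms(1-4) by (simp add: commutator_def m_assoc inv_mult_group)
  also have "\<dots> = v \<otimes> commutator G b f \<otimes> inv v"
    using assms(1-4) comm[OF vb] by (simp add: commutator_def m_assoc flip: m_assoc[of v b])
  also have "\<dots> = commutator G b f"
    using assms(1-4) comm[OF vbf] by (simp add: m_assoc)
  finally show ?thesis .
qed

text \<open>Allows two homomorphisms to be compared on generators of a subgroup.\<close>

lemma subgroup_equalizer:
  assumes "group_hom G H h" "group_hom G H h'"
  shows "subgroup {x \<in> carrier G. h x = h' x} G"
proof -
  interpret h: group_hom G H h by fact
  interpret h': group_hom G H h' by fact
  show ?thesis
    by unfold_locales auto
qed

text \<open>Write \<phi>(w) = u w and \<phi>(f) = v f with u in [R, F, ..., F] (k copies of F) and v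
  in R. Modulo the next such commutator subgroup u is central, and v commutes with gamma_{k+1},
  hence with w and [w, f]. So \<phi> fixes the generator [w, f] there.\<close>

lemma endomorphism_fixes_lower_central_mod:
  assumes "group F" and R: "R \<lhd> F" and \<phi>: "\<phi> \<in> hom F F"
    and \<phi>R: "\<And>w. w \<in> carrier F \<Longrightarrow> \<phi> w \<otimes>\<^bsub>F\<^esub> inv\<^bsub>F\<^esub> w \<in> R"
    and "w \<in> lower_central F (Suc k)"
  shows "\<phi> w \<otimes>\<^bsub>F\<^esub> inv\<^bsub>F\<^esub> w \<in> iter_comm F R k"
  using assms(5)
proof (induction k arbitrary: w)
  case 0
  then show ?case
    using \<phi>R group.lower_central_closed[OF \<open>group F\<close>] by auto
next
  case (Suc k)
  interpret F: group F by fact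
  interpret \<phi>: group_hom F F \<phi>
    using \<phi> by unfold_locales
  let ?S = "iter_comm F R (Suc k)"
  have S: "?S \<lhd> F" "subgroup ?S F"
    using F.iter_comm_normal[OF R] normal_imp_subgroup by blast+
  interpret Q: group_hom F "F Mod ?S" "\<lambda>a. ?S #>\<^bsub>F\<^esub> a"
    using S(1) by (rule F.group_hom_FactGroup)
  have eq_iff: "\<phi> w \<otimes>\<^bsub>F\<^esub> inv\<^bsub>F\<^esub> w \<in> ?S \<longleftrightarrow> ?S #>\<^bsub>F\<^esub> \<phi> w = ?S #>\<^bsub>F\<^esub> w" if "w \<in> carrier F" for w
    using F.rcos_eq_iff[OF S(2)] that by simp
  have one: "?S #>\<^bsub>F\<^esub> a = \<one>\<^bsub>F Mod ?S\<^esub>" if "a \<in> ?S" for a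
    using that F.kernel_FactGroup[OF S(1)] by (auto simp: kernel_def)
  have "lower_central F (Suc (Suc k)) \<subseteq> {w \<in> carrier F. ?S #>\<^bsub>F\<^esub> \<phi> w = ?S #>\<^bsub>F\<^esub> w}"
    unfolding F.lower_central_Suc[of "Suc k", simplified]
  proof (rule F.comm_subgroup_least)
    have "group_hom F (F Mod ?S) ((\<lambda>a. ?S #>\<^bsub>F\<^esub> a) \<circ> \<phi>)"
      using hom_compose[OF \<phi> Q.homh] by unfold_locales
    from subgroup_equalizer[OF this Q.group_hom_axioms]
    show "subgroup {w \<in> carrier F. ?S #>\<^bsub>F\<^esub> \<phi> w = ?S #>\<^bsub>F\<^esub> w} F"
      by simp
  next
    fix w f assume w: "w \<in> lower_central F (Suc k)" and f: "f \<in> carrier F"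
    have wc: "w \<in> carrier F"
      using w by (rule F.lower_central_closed)
    define u where "u = \<phi> w \<otimes>\<^bsub>F\<^esub> inv\<^bsub>F\<^esub> w"
    define v where "v = \<phi> f \<otimes>\<^bsub>F\<^esub> inv\<^bsub>F\<^esub> f"
    have uv: "\<phi> w = u \<otimes>\<^bsub>F\<^esub> w" "\<phi> f = v \<otimes>\<^bsub>F\<^esub> f" "u \<in> carrier F" "v \<in> carrier F"
      using wc f by (simp_all add: u_def v_def F.m_assoc)
    have u: "u \<in> iter_comm F R k"
      using Suc.IH w by (simp add: u_def)
    have v: "v \<in> R"
      using \<phi>R f by (simp add: v_def)
    have vw: "commutator F v x \<in> ?S" if "x \<in> lower_central F (Suc k)" for x
      using F.commutator_in_iter_comm[OF _ R v that] by simp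
    have wf: "commutator F w f \<in> lower_central F (Suc k)"
      using F.commutator_in_normal_left[OF F.lower_central_normal w f] .
    let ?q = "\<lambda>a. ?S #>\<^bsub>F\<^esub> a"
    have "?q (\<phi> (commutator F w f)) = commutator (F Mod ?S) (?q u \<otimes>\<^bsub>F Mod ?S\<^esub> ?q w) (?q v \<otimes>\<^bsub>F Mod ?S\<^esub> ?q f)"
      using wc f uv by (simp add: \<phi>.hom_commutator Q.hom_commutator del: mult_FactGroup iter_comm.simps)
    also have "\<dots> = commutator (F Mod ?S) (?q w) (?q f)"
    proof (rule Q.H.commutator_mult_commuting)
      fix g assume "g \<in> carrier (F Mod ?S)"
      then obtain x where x: "x \<in> carrier F" "g = ?q x"
        by (auto simp: carrier_FactGroup)
      then have "commutator F u x \<in> ?S"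
        using u by (auto intro: F.commutator_in_comm_subgroup)
      then show "commutator (F Mod ?S) (?q u) g = \<one>\<^bsub>F Mod ?S\<^esub>"
        using one x uv by (metis Q.hom_commutator)
    next
      show "commutator (F Mod ?S) (?q v) (?q w) = \<one>\<^bsub>F Mod ?S\<^esub>"
        using wc uv one[OF vw[OF w]] Q.hom_commutator by metis
      show "commutator (F Mod ?S) (?q v) (commutator (F Mod ?S) (?q w) (?q f)) = \<one>\<^bsub>F Mod ?S\<^esub>"
        using wc f uv one[OF vw[OF wf]] Q.hom_commutator F.commutator_closed by metis
    qed (use wc f uv Q.hom_closed in blast)+
    also have "\<dots> = ?q (commutator F w f)"
      by (rule Q.hom_commutator[OF wc f, symmetric])
    finally show "commutator F w f \<in> {w \<in> carrier F. ?q (\<phi> w) = ?q w}"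
      using wc f by simp
  qed
  then show ?case
    using Suc.prems eq_iff by blast
qed

text \<open>By the preceding lemma both composites are the identity on the numerators modulo the
  denominators. So \<open>f\<close> followed by the projection is onto, its kernel is exactly
  \<open>B\<close>, and the first isomorphism theorem applies.\<close>

lemma baer_invariant_iso:
  assumes "group F" "group F'" and R: "R \<lhd> F" and R': "R' \<lhd> F'"
    and f: "f \<in> hom F F'" "f ` R \<subseteq> R'" and g: "g \<in> hom F' F" "g ` R' \<subseteq> R"
    and gf: "\<And>w. w \<in> carrier F \<Longrightarrow> g (f w) \<otimes>\<^bsub>F\<^esub> inv\<^bsub>F\<^esub> w \<in> R"
    and fg: "\<And>w. w \<in> carrier F' \<Longrightarrow> f (g w) \<otimes>\<^bsub>F'\<^esub> inv\<^bsub>F'\<^esub> w \<in> R'"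
  shows "baer_invariant c F R \<cong> baer_invariant c F' R'"
proof -
  interpret F: group F by fact
  interpret F': group F' by fact
  interpret f: group_hom F F' f
    using f by unfold_locales
  interpret g: group_hom F' F g
    using g by unfold_locales
  define A B A' B' where "A = R \<inter> lower_central F (c + 1)" and "B = iter_comm F R c"
    and "A' = R' \<inter> lower_central F' (c + 1)" and "B' = iter_comm F' R' c"
  have A: "subgroup A F" and A': "subgroup A' F'"
    unfolding A_def A'_def
    by (intro F.subgroups_Inter_pair F'.subgroups_Inter_pair normal_imp_subgroup R R'
        F.lower_central_normal F'.lower_central_normal)+
  have B: "subgroup B F" and B': "B' \<lhd> F'" "subgroup B' F'"
    unfolding B_def B'_def
    by (intro normal_imp_subgroup F.iter_comm_normal F'.iter_comm_normal R R')+
  have BA: "B \<subseteq> A" and BA': "B' \<subseteq> A'"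
    unfolding A_def B_def A'_def B'_def
    using F.iter_comm_subset[OF R] F'.iter_comm_subset[OF R']
      F.iter_comm_subset_lower_central[OF R] F'.iter_comm_subset_lower_central[OF R'] by blast+
  have fA: "f x \<in> A'" if "x \<in> A" for x
    using that f(2) f.hom_lower_central[of "c + 1"] by (auto simp: A_def A'_def)
  have gA: "g x \<in> A" if "x \<in> A'" for x
    using that g(2) g.hom_lower_central[of "c + 1"] by (auto simp: A_def A'_def)
  have Ac: "x \<in> carrier F" if "x \<in> A" for x
    using that A subgroup.mem_carrier by metis
  have Ac': "x \<in> carrier F'" if "x \<in> A'" for x
    using that A' subgroup.mem_carrier by metis
  have gfB: "g (f x) \<otimes>\<^bsub>F\<^esub> inv\<^bsub>F\<^esub> x \<in> B" if "x \<in> A" for x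
    using endomorphism_fixes_lower_central_mod[OF F.is_group R hom_compose[OF f(1) g(1)], of x c] gf that
    by (simp add: A_def B_def)
  have fgB: "f (g x) \<otimes>\<^bsub>F'\<^esub> inv\<^bsub>F'\<^esub> x \<in> B'" if "x \<in> A'" for x
    using endomorphism_fixes_lower_central_mod[OF F'.is_group R' hom_compose[OF g(1) f(1)], of x c] fg that
    by (simp add: A'_def B'_def)
  let ?FA = "F\<lparr>carrier := A\<rparr>" and ?FA' = "F'\<lparr>carrier := A'\<rparr>"
  let ?q = "\<lambda>a. B' #>\<^bsub>?FA'\<^esub> a"
  have q: "?q a = B' #>\<^bsub>F'\<^esub> a" for a
    by (simp add: r_coset_def)
  interpret FA: group ?FA
    using A by (rule F.subgroup_imp_group)
  interpret FA': group ?FA'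
    using A' by (rule F'.subgroup_imp_group)
  have NB': "B' \<lhd> ?FA'"
    using A' B'(1) BA' by (rule F'.normal_restrict_supergroup)
  interpret Q: group_hom ?FA' "?FA' Mod B'" ?q
    using NB' by (rule FA'.group_hom_FactGroup)
  interpret h: group_hom ?FA "?FA' Mod B'" "?q \<circ> f"
  proof unfold_locales
    have "f \<in> hom ?FA ?FA'"
      using fA Ac by (auto intro!: homI)
    then show "?q \<circ> f \<in> hom ?FA (?FA' Mod B')"
      using Q.homh by (rule hom_compose)
  qed
  have "(?q \<circ> f) ` carrier ?FA = carrier (?FA' Mod B')"
  proof
    show "carrier (?FA' Mod B') \<subseteq> (?q \<circ> f) ` carrier ?FA"
    proof
      fix C assume "C \<in> carrier (?FA' Mod B')"
      then obtain y where y: "y \<in> A'" "C = ?q y"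
        by (auto simp: carrier_FactGroup)
      \<comment> \<open>The coset of \<open>y\<close> is hit by \<open>g y\<close>, since
        \<open>f (g y)\<close> differs from \<open>y\<close> by an element of
        \<open>B'\<close>.\<close>
      then have "C = ?q (f (g y))"
        using fgB[OF y(1)] Ac' fA gA F'.rcos_eq_iff[OF B'(2), of "f (g y)" y] by (simp add: q)
      then show "C \<in> (?q \<circ> f) ` carrier ?FA"
        using gA[OF y(1)] by auto
    qed
  qed (use h.hom_closed in blast)
  moreover have "kernel ?FA (?FA' Mod B') (?q \<circ> f) = B"
  proof
    show "kernel ?FA (?FA' Mod B') (?q \<circ> f) \<subseteq> B"
    proof
      fix x assume "x \<in> kernel ?FA (?FA' Mod B') (?q \<circ> f)"
      then have x: "x \<in> A" and "?q (f x) = B'"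
        by (auto simp: kernel_def FactGroup_def)
      then have "f x \<in> B'"
        using F'.coset_join1[OF _ _ B'(2)] Ac' fA by (simp add: q)
      then have "g (f x) \<in> B"
        using g.hom_iter_comm[OF R' g(2), of c] by (auto simp: B_def B'_def)
      \<comment> \<open>Both factors lie in \<open>B\<close>: the first because
        \<open>g (f x)\<close> differs from \<open>x\<close> within \<open>B\<close>, the second
        because \<open>g\<close> maps \<open>B'\<close> into \<open>B\<close>.\<close>
      moreover have "x = inv\<^bsub>F\<^esub> (g (f x) \<otimes>\<^bsub>F\<^esub> inv\<^bsub>F\<^esub> x) \<otimes>\<^bsub>F\<^esub> g (f x)"
        using Ac[OF x] by (simp add: F.inv_mult_group F.m_assoc)
      ultimately show "x \<in> B"
        using gfB[OF x] B by (metis subgroup.m_closed subgroup.m_inv_closed)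
    qed
    show "B \<subseteq> kernel ?FA (?FA' Mod B') (?q \<circ> f)"
    proof
      fix x assume x: "x \<in> B"
      then have "f x \<in> B'"
        using f.hom_iter_comm[OF R f(2), of c] by (auto simp: B_def B'_def)
      then show "x \<in> kernel ?FA (?FA' Mod B') (?q \<circ> f)"
        using x BA BA' Ac' F'.coset_join2[OF _ B'(2), of "f x"] by (auto simp: kernel_def FactGroup_def q)
    qed
  qed
  ultimately have "?FA Mod B \<cong> ?FA' Mod B'"
    using h.FactGroup_iso by simp
  then show ?thesis
    by (simp add: baer_invariant_def A_def B_def A'_def B'_def)
qed

section \<open>The Magnus representation\<close>

definition order_ge :: "nat \<Rightarrow> series set" where
  "order_ge n = {f. \<forall>w. length w < n \<longrightarrow> coeff f w = 0}"

definition homogeneous :: "nat \<Rightarrow> series set" where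
  "homogeneous n = {f. \<forall>w. length w \<noteq> n \<longrightarrow> coeff f w = 0}"

lemma order_ge_add: "f \<in> order_ge n \<Longrightarrow> g \<in> order_ge n \<Longrightarrow> f + g \<in> order_ge n"
  and order_ge_diff: "f \<in> order_ge n \<Longrightarrow> g \<in> order_ge n \<Longrightarrow> f - g \<in> order_ge n"
  and order_ge_minus: "f \<in> order_ge n \<Longrightarrow> - f \<in> order_ge n"
  and order_ge_zero: "0 \<in> order_ge n"
  by (simp_all add: order_ge_def)

lemma order_ge_0 [simp]: "f \<in> order_ge 0"
  by (simp add: order_ge_def)

lemma order_ge_antimono: "f \<in> order_ge n \<Longrightarrow> m \<le> n \<Longrightarrow> f \<in> order_ge m"
  by (simp add: order_ge_def)

lemma homogeneous_order_ge: "f \<in> homogeneous n \<Longrightarrow> f \<in> order_ge n"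
  by (simp add: homogeneous_def order_ge_def)

lemma conv_order_ge:
  "\<forall>v. length v < i \<longrightarrow> f v = 0 \<Longrightarrow> \<forall>v. length v < j \<longrightarrow> g v = 0 \<Longrightarrow> length w < i + j \<Longrightarrow> conv f g w = 0"
proof (induction w arbitrary: f i)
  case (Cons a w)
  have "f [] = 0 \<or> g (a # w) = 0"
    using Cons.prems by (cases i) auto
  moreover have "conv (\<lambda>v. f (a # v)) g w = 0"
    \<comment> \<open>For \<open>i = 0\<close> truncated subtraction keeps the index at
      \<open>0\<close>, and the length bound for the shorter word still holds.\<close>
    by (rule Cons.IH[of "i - 1"]) (use Cons.prems in auto)
  ultimately show ?case by auto
qed auto

lemma order_ge_mult: "f \<in> order_ge i \<Longrightarrow> g \<in> order_ge j \<Longrightarrow> f * g \<in> order_ge (i + j)"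
  using conv_order_ge[of i "coeff f" j "coeff g"] by (simp add: order_ge_def coeff_mult)

lemma order_ge_mult_left: "g \<in> order_ge n \<Longrightarrow> f * g \<in> order_ge n"
  and order_ge_mult_right: "g \<in> order_ge n \<Longrightarrow> g * f \<in> order_ge n"
  using order_ge_mult[of f 0 g n] order_ge_mult[of g n f 0] by simp_all

lemma conv_homogeneous:
  "\<forall>v. length v \<noteq> i \<longrightarrow> f v = 0 \<Longrightarrow> \<forall>v. length v \<noteq> j \<longrightarrow> g v = 0 \<Longrightarrow> length w \<noteq> i + j \<Longrightarrow> conv f g w = 0"
proof (induction w arbitrary: f i)
  case (Cons a w)
  have "f [] = 0 \<or> g (a # w) = 0"
    using Cons.prems by (cases i) auto
  moreover have "conv (\<lambda>v. f (a # v)) g w = 0"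
  proof (cases i)
    case 0
    then have "(\<lambda>v. f (a # v)) = (\<lambda>v. 0)"
      using Cons.prems by auto
    then show ?thesis
      by (simp add: conv_zero_left)
  next
    case (Suc i')
    then show ?thesis
      using Cons.prems by (intro Cons.IH[of i']) auto
  qed
  ultimately show ?case by auto
qed auto

lemma homogeneous_lie: "lie b \<in> homogeneous (weight b)"
proof (induction b)
  case (Br u v)
  have "lie u * lie v \<in> homogeneous (weight u + weight v)"
    using Br conv_homogeneous[of "weight u" "coeff (lie u)" "weight v" "coeff (lie v)"]
    by (simp add: homogeneous_def coeff_mult)
  moreover have "lie v * lie u \<in> homogeneous (weight u + weight v)"
    using Br conv_homogeneous[of "weight v" "coeff (lie v)" "weight u" "coeff (lie u)"]
    by (simp add: homogeneous_def coeff_mult add.commute)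
  ultimately show ?case
    by (simp add: homogeneous_def)
qed (simp add: homogeneous_def)

definition hom_part :: "nat \<Rightarrow> series \<Rightarrow> series" where
  "hom_part n f = Series (\<lambda>w. if length w = n then coeff f w else 0)"

lemma coeff_hom_part [simp]: "coeff (hom_part n f) w = (if length w = n then coeff f w else 0)"
  by (simp add: hom_part_def)

lemma hom_part_add: "hom_part n (f + g) = hom_part n f + hom_part n g"
  by (rule series_eqI) simp

lemma hom_part_homogeneous: "f \<in> homogeneous n \<Longrightarrow> hom_part n f = f"
  by (rule series_eqI) (simp add: homogeneous_def)

lemma hom_part_order_ge: "f \<in> order_ge (Suc n) \<Longrightarrow> hom_part n f = 0"
  by (rule series_eqI) (simp add: order_ge_def)

lemma hom_part_1: "n \<ge> 1 \<Longrightarrow> hom_part n 1 = 0"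
  by (rule series_eqI) auto

section \<open>The group of invertible series\<close>

definition series_units :: "series monoid" where
  "series_units = \<lparr>carrier = {f. \<exists>g. f * g = 1 \<and> g * f = 1}, monoid.mult = (*), one = 1\<rparr>"

lemma mult_series_units [simp]: "f \<otimes>\<^bsub>series_units\<^esub> g = f * g"
  and one_series_units [simp]: "\<one>\<^bsub>series_units\<^esub> = 1"
  by (simp_all add: series_units_def)

lemma group_series_units: "group series_units"
proof (rule groupI)
  fix f g assume "f \<in> carrier series_units" "g \<in> carrier series_units"
  then obtain f' g' where "f * f' = 1" "f' * f = 1" "g * g' = 1" "g' * g = 1"
    by (auto simp: series_units_def)
  then have "(f * g) * (g' * f') = 1 \<and> (g' * f') * (f * g) = 1"
    by (metis mult.assoc mult_1_right)
  then show "f \<otimes>\<^bsub>series_units\<^esub> g \<in> carrier series_units"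
    by (auto simp: series_units_def)
qed (auto simp: series_units_def mult.assoc)

lemma coeff_mult_var:
  "coeff (f * var a) w = (if w \<noteq> [] \<and> last w = a then coeff f (butlast w) else 0)"
proof -
  have "conv h (\<lambda>w. if w = [a] then 1 else 0) w = (if w \<noteq> [] \<and> last w = a then h (butlast w) else 0)" for h
    by (induction w arbitrary: h) auto
  moreover have "coeff (var a) = (\<lambda>w. if w = [a] then 1 else 0)"
    by (rule ext) simp
  ultimately show ?thesis
    by (simp add: coeff_mult)
qed

text \<open>The inverse is the geometric series \<open>\<Sum>n. (-a)^n\<close>.\<close>

lemma one_plus_var_unit: "1 + var a \<in> carrier series_units"
proof -
  define g where "g = Series (\<lambda>w. if set w \<subseteq> {a} then (-1) ^ length w else 0)"
  have "(1 + var a) * g = 1"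
  proof (rule series_eqI)
    fix w show "coeff ((1 + var a) * g) w = coeff 1 w"
      by (cases w) (auto simp: distrib_right g_def)
  qed
  moreover have "g * (1 + var a) = 1"
  proof (rule series_eqI)
    fix w show "coeff (g * (1 + var a)) w = coeff 1 w"
      by (cases w rule: rev_cases) (auto simp: distrib_left coeff_mult_var g_def)
  qed
  ultimately show ?thesis
    by (auto simp: series_units_def)
qed

text \<open>Freeness enters the lemmas of this locale only through the existence of
  \<open>\<mu>\<close>.\<close>

locale magnus = generated_group +
  fixes \<mu> :: "'a \<Rightarrow> series"
  assumes \<mu>_hom: "\<mu> \<in> hom G series_units"
    and \<mu>_gen: "i < q \<Longrightarrow> \<mu> (\<xi> i) = 1 + var i"
begin

lemma \<mu>_mult: "g \<in> carrier G \<Longrightarrow> h \<in> carrier G \<Longrightarrow> \<mu> (g \<otimes> h) = \<mu> g * \<mu> h"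
  using \<mu>_hom by (simp add: hom_def)

lemma \<mu>_one: "\<mu> \<one> = 1"
  using hom_one[OF \<mu>_hom is_group group_series_units] by simp

lemma \<mu>_inv: "g \<in> carrier G \<Longrightarrow> \<mu> (inv g) * \<mu> g = 1" "g \<in> carrier G \<Longrightarrow> \<mu> g * \<mu> (inv g) = 1"
  by (simp_all add: \<mu>_one flip: \<mu>_mult)

definition dimension_subgroup :: "nat \<Rightarrow> 'a set" where
  "dimension_subgroup n = {g \<in> carrier G. \<mu> g - 1 \<in> order_ge n}"

lemma subgroup_dimension_subgroup: "subgroup (dimension_subgroup n) G"
proof (rule subgroupI)
  show "dimension_subgroup n \<noteq> {}"
    by (auto simp: dimension_subgroup_def \<mu>_one order_ge_zero intro!: exI[of _ \<one>])
next
  fix g h assume gh: "g \<in> dimension_subgroup n" "h \<in> dimension_subgroup n"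
  have "\<mu> (g \<otimes> h) - 1 = (\<mu> g - 1) * \<mu> h + (\<mu> h - 1)"
    using gh by (simp add: dimension_subgroup_def \<mu>_mult algebra_simps)
  moreover have "(\<mu> g - 1) * \<mu> h + (\<mu> h - 1) \<in> order_ge n"
    using gh by (intro order_ge_add order_ge_mult_right) (auto simp: dimension_subgroup_def)
  ultimately have "\<mu> (g \<otimes> h) - 1 \<in> order_ge n"
    by metis
  then show "g \<otimes> h \<in> dimension_subgroup n"
    using gh by (simp add: dimension_subgroup_def)
next
  fix g assume g: "g \<in> dimension_subgroup n"
  then have "\<mu> (inv g) - 1 = - (\<mu> (inv g) * (\<mu> g - 1))"
    by (simp add: dimension_subgroup_def \<mu>_inv algebra_simps)
  then show "inv g \<in> dimension_subgroup n"
    using g by (auto simp: dimension_subgroup_def intro!: order_ge_minus order_ge_mult_left)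
qed (auto simp: dimension_subgroup_def)

lemma dimension_subgroup_1: "dimension_subgroup 1 = carrier G"
proof
  have "\<xi> ` {..<q} \<subseteq> dimension_subgroup 1"
    using gens_closed by (auto simp: dimension_subgroup_def \<mu>_gen order_ge_def)
  from generate_subgroup_incl[OF this subgroup_dimension_subgroup]
  show "carrier G \<subseteq> dimension_subgroup 1"
    by (simp add: generates)
qed (auto simp: dimension_subgroup_def)

text \<open>Put a = \<mu>(g) - 1 and b = \<mu>(h) - 1. Then \<mu>([g, h]) - 1 = (ab - ba) z, where z
  is the image of g^-1 h^-1. As z has constant term 1, it alters only terms of higher order.\<close>

lemma \<mu>_commutator:
  assumes g: "g \<in> dimension_subgroup i" and h: "h \<in> dimension_subgroup j"
  shows "\<mu> (commutator G g h) - 1 - ((\<mu> g - 1) * (\<mu> h - 1) - (\<mu> h - 1) * (\<mu> g - 1)) \<in> order_ge (Suc (i + j))"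
proof -
  have gc: "g \<in> carrier G" and hc: "h \<in> carrier G"
    using g h by (auto simp: dimension_subgroup_def)
  define l where "l = (\<mu> g - 1) * (\<mu> h - 1) - (\<mu> h - 1) * (\<mu> g - 1)"
  \<comment> \<open>Right multiplication by \<open>z\<close> turns the image of gh into that of
    [g, h] and the image of hg into 1.\<close>
  define z where "z = \<mu> (inv g) * \<mu> (inv h)"
  have "inv g \<otimes> inv h \<in> dimension_subgroup 1"
    using gc hc by (simp only: dimension_subgroup_1) simp
  then have z: "z - 1 \<in> order_ge 1"
    using gc hc by (simp add: dimension_subgroup_def \<mu>_mult z_def)
  have "l \<in> order_ge (i + j)"
    unfolding l_def using g h order_ge_mult[of "\<mu> g - 1" i "\<mu> h - 1" j] order_ge_mult[of "\<mu> h - 1" j "\<mu> g - 1" i]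
    by (intro order_ge_diff) (auto simp: dimension_subgroup_def add.commute)
  then have lz: "l * (z - 1) \<in> order_ge (Suc (i + j))"
    using order_ge_mult[OF _ z] by simp
  have "\<mu> g * \<mu> h - \<mu> h * \<mu> g = l"
    by (simp add: l_def algebra_simps)
  moreover have "\<mu> h * \<mu> g * z = 1"
  proof -
    have "\<mu> h * \<mu> g * z = \<mu> h * (\<mu> g * \<mu> (inv g)) * \<mu> (inv h)"
      by (simp add: z_def mult.assoc)
    then show ?thesis
      using gc hc by (simp add: \<mu>_inv)
  qed
  moreover have "\<mu> (commutator G g h) = \<mu> g * \<mu> h * z"
    using gc hc by (simp add: commutator_def \<mu>_mult z_def mult.assoc)
  ultimately have "\<mu> (commutator G g h) - 1 - l = l * (z - 1)"
    by (metis left_diff_distrib right_diff_distrib mult_1_right)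
  then show ?thesis
    using lz by (simp add: l_def)
qed

lemma commutator_in_dimension_subgroup:
  assumes g: "g \<in> dimension_subgroup i" and h: "h \<in> dimension_subgroup j"
  shows "commutator G g h \<in> dimension_subgroup (i + j)"
proof -
  let ?l = "(\<mu> g - 1) * (\<mu> h - 1) - (\<mu> h - 1) * (\<mu> g - 1)"
  have "?l \<in> order_ge (i + j)"
    using g h order_ge_mult[of "\<mu> g - 1" i "\<mu> h - 1" j] order_ge_mult[of "\<mu> h - 1" j "\<mu> g - 1" i]
    by (intro order_ge_diff) (auto simp: dimension_subgroup_def add.commute)
  moreover have "\<mu> (commutator G g h) - 1 - ?l \<in> order_ge (i + j)"
    using \<mu>_commutator[OF g h] by (rule order_ge_antimono) simp
  ultimately have "(\<mu> (commutator G g h) - 1 - ?l) + ?l \<in> order_ge (i + j)"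
    by (intro order_ge_add)
  then show ?thesis
    using g h by (simp add: dimension_subgroup_def)
qed

lemma lower_central_subset_dimension_subgroup:
  "n \<ge> 1 \<Longrightarrow> lower_central G n \<subseteq> dimension_subgroup n"
proof (induction n rule: nat_induct_at_least)
  case base
  show ?case
    using dimension_subgroup_1 by (simp add: lower_central_1)
next
  case (Suc n)
  show ?case
    unfolding lower_central_Suc[OF Suc.hyps]
  proof (rule comm_subgroup_least[OF subgroup_dimension_subgroup])
    fix g h assume "g \<in> lower_central G n" "h \<in> carrier G"
    then have "g \<in> dimension_subgroup n" "h \<in> dimension_subgroup 1"
      using Suc.IH dimension_subgroup_1 by auto
    from commutator_in_dimension_subgroup[OF this]
    show "commutator G g h \<in> dimension_subgroup (Suc n)"
      by simp
  qed
qed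

text \<open>Group commutators have the Lie commutators of the leading parts as their own leading
  parts, by \<open>\<mu>_commutator\<close>; so the bracket structure carries over.\<close>

lemma \<mu>_ev:
  "set_bracket b \<subseteq> {..<q} \<Longrightarrow> \<mu> (ev b) - 1 - lie b \<in> order_ge (Suc (weight b))"
proof (induction b)
  case (Letter i)
  then show ?case
    by (simp add: \<mu>_gen order_ge_zero)
next
  case (Br u v)
  define a where "a = \<mu> (ev u) - 1"
  define b where "b = \<mu> (ev v) - 1"
  let ?i = "weight u" and ?j = "weight v"
  have uv: "set_bracket u \<subseteq> {..<q}" "set_bracket v \<subseteq> {..<q}"
    using Br.prems by auto
  have pos: "?i \<ge> 1" "?j \<ge> 1"
    using weight_pos[of u] weight_pos[of v] by linarith+
  have D: "ev u \<in> dimension_subgroup ?i" "ev v \<in> dimension_subgroup ?j"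
    using uv eval_in_lower_central lower_central_subset_dimension_subgroup pos by blast+
  then have ab: "a \<in> order_ge ?i" "b \<in> order_ge ?j"
    by (auto simp: dimension_subgroup_def a_def b_def)
  have L: "lie u \<in> order_ge ?i" "lie v \<in> order_ge ?j"
    using homogeneous_lie homogeneous_order_ge by blast+
  have d: "a - lie u \<in> order_ge (Suc ?i)" "b - lie v \<in> order_ge (Suc ?j)"
    using Br uv by (simp_all add: a_def b_def)
  \<comment> \<open>In ab and ba one factor at a time is exchanged for its leading part; each of the
    four errors contains a factor whose order is one higher.\<close>
  have "(a - lie u) * b + lie u * (b - lie v) - ((b - lie v) * a + lie v * (a - lie u)) \<in> order_ge (Suc (?i + ?j))"
    using order_ge_mult[OF d(1) ab(2)] order_ge_mult[OF L(1) d(2)]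
      order_ge_mult[OF d(2) ab(1)] order_ge_mult[OF L(2) d(1)]
    by (intro order_ge_add order_ge_diff) (simp_all add: add.commute)
  also have "(a - lie u) * b + lie u * (b - lie v) - ((b - lie v) * a + lie v * (a - lie u)) =
      (a * b - b * a) - lie (Br u v)"
    by (simp add: algebra_simps)
  finally have "(a * b - b * a) - lie (Br u v) \<in> order_ge (Suc (?i + ?j))" .
  from order_ge_add[OF \<mu>_commutator[OF D] this]
  show ?case
    by (simp add: a_def b_def algebra_simps)
qed

section \<open>Leading terms on the lower central series\<close>

definition lead :: "nat \<Rightarrow> 'a \<Rightarrow> series" where
  "lead n g = hom_part n (\<mu> g)"

text \<open>In gh - 1 = (g - 1) + (h - 1) + (g - 1)(h - 1), read for the images under
  \<open>\<mu>\<close>, the product has order at least 2n, which exceeds n because n is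
  positive.\<close>

lemma lead_mult:
  assumes "n \<ge> 1" "g \<in> lower_central G n" "h \<in> lower_central G n"
  shows "lead n (g \<otimes> h) = lead n g + lead n h"
proof -
  have D: "g \<in> dimension_subgroup n" "h \<in> dimension_subgroup n"
    using assms lower_central_subset_dimension_subgroup by auto
  then have "(\<mu> g - 1) * (\<mu> h - 1) \<in> order_ge (n + n)"
    by (intro order_ge_mult) (auto simp: dimension_subgroup_def)
  then have "(\<mu> g - 1) * (\<mu> h - 1) \<in> order_ge (Suc n)"
    by (rule order_ge_antimono) (use assms(1) in simp)
  then have "hom_part n ((\<mu> g - 1) * (\<mu> h - 1)) = 0"
    by (rule hom_part_order_ge)
  moreover have "\<mu> (g \<otimes> h) + 1 = (\<mu> g + \<mu> h) + (\<mu> g - 1) * (\<mu> h - 1)"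
    using D by (simp add: dimension_subgroup_def \<mu>_mult algebra_simps)
  then have "hom_part n (\<mu> (g \<otimes> h) + 1) = hom_part n ((\<mu> g + \<mu> h) + (\<mu> g - 1) * (\<mu> h - 1))"
    by (rule arg_cong)
  ultimately show ?thesis
    using assms(1) by (simp add: lead_def hom_part_add hom_part_1)
qed

lemma lead_one: "n \<ge> 1 \<Longrightarrow> lead n \<one> = 0"
  by (simp add: lead_def \<mu>_one hom_part_1)

lemma lead_inv:
  assumes "n \<ge> 1" "g \<in> lower_central G n"
  shows "lead n (inv g) = - lead n g"
proof -
  have "lead n (g \<otimes> inv g) = lead n g + lead n (inv g)"
    using assms lower_central_subgroup by (intro lead_mult) (auto intro: subgroup.m_inv_closed)
  then show ?thesis
    using assms lower_central_closed lead_one by (simp add: eq_neg_iff_add_eq_0 add.commute)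
qed

lemma lead_lower_central_Suc:
  assumes "n \<ge> 1" "g \<in> lower_central G (Suc n)"
  shows "lead n g = 0"
proof -
  have "\<mu> g - 1 \<in> order_ge (Suc n)"
    using lower_central_subset_dimension_subgroup[of "Suc n"] assms by (auto simp: dimension_subgroup_def)
  then have "hom_part n ((\<mu> g - 1) + 1) = 0"
    unfolding hom_part_add using assms(1) by (simp add: hom_part_order_ge hom_part_1)
  then show ?thesis
    by (simp add: lead_def)
qed

lemma lead_ev:
  assumes "b \<in> basics q n"
  shows "lead n (ev b) = lie b"
proof -
  have n: "n \<ge> 1"
    using weight_pos[of b] basicsD(3)[OF assms] by simp
  have "hom_part n ((\<mu> (ev b) - 1 - lie b) + 1 + lie b) = hom_part n (lie b)"
    unfolding hom_part_add using n \<mu>_ev[of b] basicsD[OF assms]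
    by (simp add: hom_part_order_ge hom_part_1)
  then show ?thesis
    using homogeneous_lie[of b] basicsD(3)[OF assms] by (simp add: lead_def hom_part_homogeneous)
qed

lemma lower_central_nat_pow_closed: "g \<in> lower_central G n \<Longrightarrow> g [^] (k :: nat) \<in> lower_central G n"
  by (induction k) (auto intro: subgroup.one_closed subgroup.m_closed lower_central_subgroup)

lemma lower_central_int_pow_closed: "g \<in> lower_central G n \<Longrightarrow> g [^] (k :: int) \<in> lower_central G n"
  by (rule subgroup_int_pow_closed[OF lower_central_subgroup])

lemma lead_nat_pow:
  assumes "n \<ge> 1" "g \<in> lower_central G n"
  shows "lead n (g [^] (k :: nat)) = real k *\<^sub>R lead n g"
  by (induction k)
     (use assms in \<open>auto simp: lead_one lead_mult lower_central_nat_pow_closed algebra_simps\<close>)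

lemma lead_int_pow:
  assumes "n \<ge> 1" "g \<in> lower_central G n"
  shows "lead n (g [^] (k :: int)) = real_of_int k *\<^sub>R lead n g"
  using assms by (cases k rule: int_cases2)
    (auto simp: int_pow_int int_pow_neg_int lower_central_closed lead_nat_pow lead_inv lower_central_nat_pow_closed)

definition partial_span :: "nat \<Rightarrow> nat bracket set \<Rightarrow> 'a set" where
  "partial_span n B = generate G (ev ` B \<union> lower_central G (Suc n))"

lemma partial_span_subgroup: "B \<subseteq> basics q n \<Longrightarrow> subgroup (partial_span n B) G"
  unfolding partial_span_def using basic_span_gens by (intro generate_is_subgroup) blast

lemma partial_span_subset:
  "B \<subseteq> basics q n \<Longrightarrow> partial_span n B \<subseteq> lower_central G n"
  unfolding partial_span_def
  using basic_span_subset_lower_central[of n] lower_central_subset_basic_span[of n] eval_in_basic_span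
  by (intro generate_subgroup_incl lower_central_subgroup) blast

lemma lower_central_subset_partial_span: "lower_central G (Suc n) \<subseteq> partial_span n B"
  unfolding partial_span_def by (auto intro: generate.incl)

lemma partial_span_normal:
  "n \<ge> 1 \<Longrightarrow> B \<subseteq> basics q n \<Longrightarrow> partial_span n B \<lhd> G"
  using partial_span_subgroup partial_span_subset lower_central_subset_partial_span
  by (intro normal_between_lower_central)

text \<open>Additivity of \<open>lead n\<close> turns products and inverses of generators into
  integer combinations; this is where integrality comes from, the series themselves being
  real.\<close>

lemma lead_partial_span:
  assumes n: "n \<ge> 1" and B: "B \<subseteq> basics q n" and "g \<in> partial_span n B"
  shows "\<exists>m :: nat bracket \<Rightarrow> int. lead n g = (\<Sum>b\<in>B. m b *\<^sub>R lie b)"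
proof -
  let ?T = "{g \<in> lower_central G n. \<exists>m :: nat bracket \<Rightarrow> int. lead n g = (\<Sum>b\<in>B. m b *\<^sub>R lie b)}"
  have fin: "finite B"
    using B finite_basics finite_subset by blast
  have "subgroup ?T G"
  proof (rule subgroupI)
    have "\<one> \<in> ?T"
      using n lead_one lower_central_subgroup by (auto intro: subgroup.one_closed exI[of _ "\<lambda>_. 0"])
    then show "?T \<noteq> {}" by blast
  next
    fix g assume "g \<in> ?T"
    then obtain m :: "nat bracket \<Rightarrow> int" where g: "g \<in> lower_central G n" "lead n g = (\<Sum>b\<in>B. m b *\<^sub>R lie b)"
      by blast
    then have "lead n (inv g) = (\<Sum>b\<in>B. (- m b) *\<^sub>R lie b)"
      using n by (simp add: lead_inv sum_negf)
    then show "inv g \<in> ?T"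
      using g lower_central_subgroup
      by (auto intro: subgroup.m_inv_closed exI[of _ "\<lambda>b. - m b"])
  next
    fix g h assume "g \<in> ?T" "h \<in> ?T"
    then obtain m l :: "nat bracket \<Rightarrow> int" where gh: "g \<in> lower_central G n" "h \<in> lower_central G n"
      "lead n g = (\<Sum>b\<in>B. m b *\<^sub>R lie b)" "lead n h = (\<Sum>b\<in>B. l b *\<^sub>R lie b)"
      by blast
    then have "lead n (g \<otimes> h) = (\<Sum>b\<in>B. (m b + l b) *\<^sub>R lie b)"
      using n by (simp add: lead_mult sum.distrib scaleR_left_distrib)
    then show "g \<otimes> h \<in> ?T"
      using gh lower_central_subgroup
      by (auto intro: subgroup.m_closed exI[of _ "\<lambda>b. m b + l b"])
  qed (auto intro: lower_central_closed)
  moreover have "ev ` B \<union> lower_central G (Suc n) \<subseteq> ?T"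
  proof
    fix g assume "g \<in> ev ` B \<union> lower_central G (Suc n)"
    then consider b where "b \<in> B" "g = ev b" | "g \<in> lower_central G (Suc n)" by blast
    then show "g \<in> ?T"
    proof cases
      case 1
      then have "lead n g = (\<Sum>c\<in>B. (if c = b then 1 else 0 :: int) *\<^sub>R lie c)"
        using fin B lead_ev by (auto simp: if_distrib[of "\<lambda>x. x *\<^sub>R _"] if_distrib[of real_of_int] cong: if_cong)
      moreover have "g \<in> lower_central G n"
        using 1 B eval_in_lower_central[of b] basicsD[of b q n] by auto
      ultimately show ?thesis by (auto intro!: exI[of _ "\<lambda>c. if c = b then 1 else 0"])
    next
      case 2
      then show ?thesis
        using n lead_lower_central_Suc lower_central_antimono[of n "Suc n"]
        by (auto intro!: exI[of _ "\<lambda>_. 0"])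
    qed
  qed
  ultimately have "partial_span n B \<subseteq> ?T"
    unfolding partial_span_def by (intro generate_subgroup_incl)
  then show ?thesis
    using assms(3) by blast
qed

text \<open>Modulo the normal subgroup \<open>partial_span n B\<close>, the larger span is cyclic
  with generator \<open>ev b\<close>.\<close>

lemma partial_span_insert:
  assumes n: "n \<ge> 1" and B: "insert b B \<subseteq> basics q n" and g: "g \<in> partial_span n (insert b B)"
  shows "\<exists>k :: int. g \<otimes> ev b [^] k \<in> partial_span n B"
proof -
  let ?S = "partial_span n B" and ?e = "ev b"
  have S: "?S \<lhd> G" "subgroup ?S G"
    using partial_span_normal partial_span_subgroup B n by auto
  have e: "?e \<in> carrier G"
    using B eval_closed basicsD(2) by blast
  let ?T = "{g \<in> carrier G. \<exists>k :: int. g \<otimes> ?e [^] k \<in> ?S}"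
  have "subgroup ?T G"
  proof (rule subgroupI)
    have "\<one> \<in> ?T"
      using S e by (auto intro!: exI[of _ 0] simp: subgroup.one_closed)
    then show "?T \<noteq> {}" by blast
  next
    fix g assume "g \<in> ?T"
    then obtain k :: int where g: "g \<in> carrier G" "g \<otimes> ?e [^] k \<in> ?S"
      by blast
    have "?e [^] k \<otimes> inv (g \<otimes> ?e [^] k) \<otimes> inv (?e [^] k) \<in> ?S"
      using S e g by (intro normal_invE) (auto intro: subgroup.m_inv_closed)
    then have "inv g \<otimes> ?e [^] (- k) \<in> ?S"
      using e g by (simp add: inv_mult_group int_pow_neg m_assoc)
    then show "inv g \<in> ?T"
      using g by blast
  next
    fix g h assume "g \<in> ?T" "h \<in> ?T"
    then obtain k l :: int where gh: "g \<in> carrier G" "g \<otimes> ?e [^] k \<in> ?S" "h \<in> carrier G" "h \<otimes> ?e [^] l \<in> ?S"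
      by blast
    have "inv (?e [^] k) \<otimes> (h \<otimes> ?e [^] l) \<otimes> ?e [^] k \<in> ?S"
      using S e gh by (intro normal.inv_op_closed1) auto
    then have "(g \<otimes> ?e [^] k) \<otimes> (inv (?e [^] k) \<otimes> (h \<otimes> ?e [^] l) \<otimes> ?e [^] k) \<in> ?S"
      by (rule subgroup.m_closed[OF S(2) gh(2)])
    then have "(g \<otimes> h) \<otimes> ?e [^] (l + k) \<in> ?S"
      using e gh by (simp add: int_pow_mult m_assoc)
    then show "g \<otimes> h \<in> ?T"
      using gh by blast
  qed auto
  moreover have "ev ` insert b B \<union> lower_central G (Suc n) \<subseteq> ?T"
  proof
    fix g assume "g \<in> ev ` insert b B \<union> lower_central G (Suc n)"
    then consider "g = ?e" | "g \<in> ev ` B \<union> lower_central G (Suc n)" by blast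
    then show "g \<in> ?T"
    proof cases
      case 1
      then have "g \<otimes> ?e [^] (-1 :: int) \<in> ?S"
        using e S by (simp add: int_pow_neg subgroup.one_closed)
      then show ?thesis
        using 1 e by blast
    next
      case 2
      then have "g \<in> ?S"
        unfolding partial_span_def by (rule generate.incl)
      then have "g \<in> carrier G" "g \<otimes> ?e [^] (0 :: int) \<in> ?S"
        using S subgroup.mem_carrier by fastforce+
      then show ?thesis by blast
    qed
  qed
  ultimately have "partial_span n (insert b B) \<subseteq> ?T"
    unfolding partial_span_def[of n "insert b B"] by (intro generate_subgroup_incl)
  then show ?thesis
    using g by blast
qed

lemma lie_independent_int:
  fixes m :: "nat bracket \<Rightarrow> int"
  assumes "(\<Sum>b\<in>basics q n. m b *\<^sub>R lie b) = (\<Sum>b\<in>basics q n. l b *\<^sub>R lie b)" "b \<in> basics q n"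
  shows "m b = l b"
proof -
  have "(\<Sum>b\<in>basics q n. (real_of_int (m b) - real_of_int (l b)) *\<^sub>R lie b) = 0"
    using assms(1) by (simp add: scaleR_left_diff_distrib sum_subtractf)
  from lie_basics_independent[OF this assms(2)] show ?thesis by simp
qed

text \<open>One basic commutator is removed at a time: multiplying by a power of \<open>ev b\<close>
  lands in the smaller span, and linear independence forces the exponent to be zero.\<close>

lemma lead_eq_0_partial_span:
  assumes n: "n \<ge> 1" and "B \<subseteq> basics q n" "g \<in> partial_span n B" "lead n g = 0"
  shows "g \<in> lower_central G (Suc n)"
proof -
  have "finite B"
    using assms finite_basics finite_subset by blast
  then show ?thesis
    using assms(2-4)
  proof (induction B arbitrary: g rule: finite_induct)
    case empty
    then show ?case
      using generate_subgroup_incl[OF subset_refl lower_central_subgroup[of "Suc n"]] by (auto simp: partial_span_def)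
  next
    case (insert b B)
    then obtain k :: int where k: "g \<otimes> ev b [^] k \<in> partial_span n B"
      using partial_span_insert[OF n] by blast
    then obtain m :: "nat bracket \<Rightarrow> int" where m: "lead n (g \<otimes> ev b [^] k) = (\<Sum>c\<in>B. m c *\<^sub>R lie c)"
      using lead_partial_span[OF n] insert.prems by blast
    have b: "b \<in> basics q n" and gl: "g \<in> lower_central G n"
      using insert.prems partial_span_subset by blast+
    have el: "ev b \<in> lower_central G n"
      using eval_in_lower_central[OF basicsD(2)[OF b]] basicsD(3)[OF b] by simp
    have "lead n (g \<otimes> ev b [^] k) = k *\<^sub>R lie b"
      using n gl el b insert.prems by (simp add: lead_mult lower_central_int_pow_closed lead_int_pow lead_ev)
    \<comment> \<open>The coefficients of the relation
      \<open>k *\<^sub>R lie b - (\<Sum>c\<in>B. m c *\<^sub>R lie c) = 0\<close>, extended by zero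
      to all basic commutators of weight \<open>n\<close>.\<close>
    moreover define l where "l c = (if c = b then k else if c \<in> B then - m c else 0)" for c
    have "(\<Sum>c\<in>basics q n. l c *\<^sub>R lie c) = (\<Sum>c\<in>insert b B. l c *\<^sub>R lie c)"
      using insert.prems finite_basics by (intro sum.mono_neutral_right) (auto simp: l_def)
    moreover have "(\<Sum>c\<in>insert b B. l c *\<^sub>R lie c) = k *\<^sub>R lie b + (\<Sum>c\<in>B. - (m c *\<^sub>R lie c))"
    proof -
      have "(\<Sum>c\<in>B. l c *\<^sub>R lie c) = (\<Sum>c\<in>B. - (m c *\<^sub>R lie c))"
        using insert.hyps by (intro sum.cong) (auto simp: l_def)
      then show ?thesis
        using insert.hyps by (simp add: l_def)
    qed
    ultimately have "(\<Sum>c\<in>basics q n. l c *\<^sub>R lie c) = 0"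
      using m by (simp add: sum_negf)
    then have "l b = 0"
      using lie_basics_independent[of "\<lambda>c. real_of_int (l c)"] b by auto
    then have "g \<in> partial_span n B"
      using k gl lower_central_closed by (simp add: l_def)
    then show ?case
      using insert.IH insert.prems by blast
  qed
qed

section \<open>Integer coordinates on the lower central quotients\<close>

lemma lower_central_eq_partial_span:
  "n \<ge> 1 \<Longrightarrow> lower_central G n = partial_span n (basics q n)"
  unfolding partial_span_def basic_span_def[symmetric] by (rule lower_central_eq_basic_span)

lemma lead_eq_0:
  "n \<ge> 1 \<Longrightarrow> g \<in> lower_central G n \<Longrightarrow> lead n g = 0 \<Longrightarrow> g \<in> lower_central G (Suc n)"
  using lead_eq_0_partial_span lower_central_eq_partial_span by blast

text \<open>Linear independence determines the chosen function on \<open>basics q n\<close>; its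
  values elsewhere are unspecified.\<close>

definition coord :: "nat \<Rightarrow> 'a \<Rightarrow> nat bracket \<Rightarrow> int" where
  "coord n g = (SOME m. lead n g = (\<Sum>b\<in>basics q n. m b *\<^sub>R lie b))"

lemma lead_coord:
  assumes "n \<ge> 1" "g \<in> lower_central G n"
  shows "lead n g = (\<Sum>b\<in>basics q n. coord n g b *\<^sub>R lie b)"
  unfolding coord_def
  using assms lead_partial_span[of n "basics q n" g] lower_central_eq_partial_span[of n]
  by (intro someI_ex[of "\<lambda>m. lead n g = (\<Sum>b\<in>basics q n. real_of_int (m b) *\<^sub>R lie b)"]) auto

lemma coord_unique:
  assumes "n \<ge> 1" "g \<in> lower_central G n" "lead n g = (\<Sum>b\<in>basics q n. m b *\<^sub>R lie b)" "b \<in> basics q n"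
  shows "coord n g b = m b"
proof (rule lie_independent_int[OF _ assms(4)])
  show "(\<Sum>b\<in>basics q n. coord n g b *\<^sub>R lie b) = (\<Sum>b\<in>basics q n. m b *\<^sub>R lie b)"
    using assms lead_coord[of n g] by simp
qed

text \<open>The witness is a product of the basic commutators raised to the prescribed exponents;
  their order does not affect the leading term.\<close>

lemma ex_coord:
  fixes m :: "nat bracket \<Rightarrow> int"
  assumes n: "n \<ge> 1"
  shows "\<exists>g\<in>lower_central G n. lead n g = (\<Sum>b\<in>basics q n. m b *\<^sub>R lie b)"
proof -
  have "\<exists>g\<in>lower_central G n. lead n g = (\<Sum>b\<in>B. m b *\<^sub>R lie b)" if "finite B" "B \<subseteq> basics q n" for B
    using that
  proof (induction B rule: finite_induct)
    case empty
    then show ?case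
      using n lead_one lower_central_subgroup subgroup.one_closed by fastforce
  next
    case (insert b B)
    then obtain g where g: "g \<in> lower_central G n" "lead n g = (\<Sum>b\<in>B. m b *\<^sub>R lie b)"
      by blast
    have b: "b \<in> basics q n"
      using insert.prems by blast
    have e: "ev b \<in> lower_central G n"
      using eval_in_lower_central[OF basicsD(2)[OF b]] basicsD(3)[OF b] by simp
    have "lead n (ev b [^] m b \<otimes> g) = (\<Sum>b\<in>insert b B. m b *\<^sub>R lie b)"
      using n g e b insert.hyps by (simp add: lead_mult lower_central_int_pow_closed lead_int_pow lead_ev)
    moreover have "ev b [^] m b \<otimes> g \<in> lower_central G n"
      using g e lower_central_subgroup lower_central_int_pow_closed by (blast intro: subgroup.m_closed)
    ultimately show ?case by blast
  qed
  then show ?thesis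
    using finite_basics by blast
qed

end

section \<open>Powers in the lower central quotients\<close>

context group
begin

text \<open>The preimage in gamma_n of the subgroup of d-fold multiples in the abelian group
  gamma_n/gamma_{n+1}.\<close>

definition power_mod :: "nat \<Rightarrow> nat \<Rightarrow> 'a set" where
  "power_mod n d =
     {g \<in> carrier G. \<exists>h\<in>lower_central G n. lower_central G (Suc n) #> g = lower_central G (Suc n) #> h [^] d}"

lemma mem_iff_if_rcos_eq:
  assumes "subgroup N G" "subgroup S G" "N \<subseteq> S" "a \<in> carrier G" "b \<in> carrier G" "N #> a = N #> b"
  shows "a \<in> S \<longleftrightarrow> b \<in> S"
proof -
  have "a \<otimes> inv b \<in> N"
    using assms rcos_eq_iff by blast
  then have ab: "a \<otimes> inv b \<in> S"
    using assms by blast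
  have "a = (a \<otimes> inv b) \<otimes> b" "b = inv (a \<otimes> inv b) \<otimes> a"
    using assms(4,5) by (simp_all add: m_assoc inv_mult_group)
  then show ?thesis
    using ab assms(2) by (metis subgroup.m_closed subgroup.m_inv_closed)
qed

lemma rcos_commute:
  assumes "n \<ge> 1" "g \<in> lower_central G n" "h \<in> carrier G"
  shows "lower_central G (Suc n) #> (g \<otimes> h) = lower_central G (Suc n) #> (h \<otimes> g)"
proof -
  have "commutator G g h \<in> lower_central G (Suc n)"
    using assms by (simp add: lower_central_Suc commutator_in_comm_subgroup)
  moreover have "commutator G g h = (g \<otimes> h) \<otimes> inv (h \<otimes> g)"
    using assms lower_central_closed by (simp add: commutator_def inv_mult_group m_assoc)
  ultimately show ?thesis
    using assms lower_central_closed lower_central_subgroup by (subst rcos_eq_iff) auto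
qed

lemma rcos_pow_mult:
  assumes n: "n \<ge> 1" and g: "g \<in> lower_central G n" and h: "h \<in> lower_central G n"
  shows "lower_central G (Suc n) #> (g \<otimes> h) [^] d = lower_central G (Suc n) #> (g [^] d \<otimes> h [^] (d :: nat))"
proof -
  let ?M = "lower_central G (Suc n)"
  interpret Q: group_hom G "G Mod ?M" "\<lambda>a. ?M #> a"
    by (rule group_hom_FactGroup[OF lower_central_normal])
  have c: "g \<in> carrier G" "h \<in> carrier G"
    using g h lower_central_closed by auto
  have "(?M #> g) \<otimes>\<^bsub>G Mod ?M\<^esub> (?M #> h) = (?M #> h) \<otimes>\<^bsub>G Mod ?M\<^esub> (?M #> g)"
    using rcos_commute[OF n g c(2)] Q.hom_mult[OF c] Q.hom_mult[OF c(2,1)] by simp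
  then have "((?M #> g) \<otimes>\<^bsub>G Mod ?M\<^esub> (?M #> h)) [^]\<^bsub>G Mod ?M\<^esub> d =
      (?M #> g) [^]\<^bsub>G Mod ?M\<^esub> d \<otimes>\<^bsub>G Mod ?M\<^esub> (?M #> h) [^]\<^bsub>G Mod ?M\<^esub> d"
    using c by (intro Q.H.pow_mult_distrib Q.hom_closed)
  then show ?thesis
    using c by (simp add: Q.hom_nat_pow Q.hom_mult del: mult_FactGroup)
qed

text \<open>The conjugations in the product formula for commutators act trivially on
  gamma_{n+1}/gamma_{n+2}, so commutation is linear in its first argument there. This linearity
  carries the exponent d from one weight to the next.\<close>

lemma rcos_commutator_pow:
  assumes n: "n \<ge> 1" and g: "g \<in> lower_central G n" and h: "h \<in> carrier G"
  shows "lower_central G (Suc (Suc n)) #> commutator G (g [^] (d :: nat)) h =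
    lower_central G (Suc (Suc n)) #> commutator G g h [^] d"
proof (induction d)
  case 0
  then show ?case
    using h by (simp add: commutator_def)
next
  case (Suc d)
  let ?M = "lower_central G (Suc (Suc n))"
  interpret Q: group_hom G "G Mod ?M" "\<lambda>a. ?M #> a"
    by (rule group_hom_FactGroup[OF lower_central_normal])
  have c: "g \<in> carrier G"
    using g lower_central_closed by auto
  have gh: "commutator G g h \<in> lower_central G (Suc n)"
    using n g h by (simp add: lower_central_Suc commutator_in_comm_subgroup)
  have "?M #> (g [^] d \<otimes> commutator G g h \<otimes> inv (g [^] d)) = ?M #> commutator G g h"
  proof -
    have "commutator G (commutator G g h) (g [^] d) \<in> ?M"
      using gh c by (simp add: lower_central_Suc[of "Suc n"] commutator_in_comm_subgroup)
    then have "commutator G (g [^] d) (commutator G g h) \<in> ?M"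
      using c h commutator_swap_iff[OF lower_central_subgroup] by simp
    then show ?thesis
      using c h by (subst rcos_eq_iff) (auto simp: lower_central_subgroup commutator_def)
  qed
  moreover have "commutator G (g [^] Suc d) h =
      g [^] d \<otimes> commutator G g h \<otimes> inv (g [^] d) \<otimes> commutator G (g [^] d) h"
    using c h by (simp add: commutator_mult_left)
  ultimately have "?M #> commutator G (g [^] Suc d) h =
      (?M #> commutator G g h) \<otimes>\<^bsub>G Mod ?M\<^esub> (?M #> commutator G g h [^] d)"
    using c h Suc by (simp del: mult_FactGroup nat_pow_Suc)
  also have "\<dots> = ?M #> (commutator G g h \<otimes> commutator G g h [^] d)"
    using c h by (intro Q.hom_mult[symmetric]) auto
  finally show ?case
    using c h by (simp only: nat_pow_Suc2 commutator_closed)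
qed

lemma power_mod_subgroup:
  assumes "n \<ge> 1"
  shows "subgroup (power_mod n d) G"
proof (rule subgroupI)
  let ?M = "lower_central G (Suc n)"
  interpret Q: group_hom G "G Mod ?M" "\<lambda>a. ?M #> a"
    by (rule group_hom_FactGroup[OF lower_central_normal])
  note L = lower_central_subgroup[of n]
  have "\<one> \<in> power_mod n d"
    using L by (auto simp: power_mod_def subgroup.one_closed intro!: bexI[of _ \<one>])
  then show "power_mod n d \<noteq> {}" by blast
  fix g assume "g \<in> power_mod n d"
  then obtain h where g: "g \<in> carrier G" and h: "h \<in> lower_central G n" "?M #> g = ?M #> h [^] d"
    by (auto simp: power_mod_def)
  then have hc: "h \<in> carrier G"
    using lower_central_closed by blast
  have "?M #> inv g = ?M #> inv h [^] d"
    using Q.hom_inv[OF g] Q.hom_inv[of "h [^] d"] h hc by (simp add: nat_pow_inv)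
  then show "inv g \<in> power_mod n d"
    using g h L by (auto simp: power_mod_def subgroup.m_inv_closed)
  fix g' assume "g' \<in> power_mod n d"
  then obtain h' where g': "g' \<in> carrier G" and h': "h' \<in> lower_central G n" "?M #> g' = ?M #> h' [^] d"
    by (auto simp: power_mod_def)
  then have hc': "h' \<in> carrier G"
    using lower_central_closed by blast
  have "?M #> (g \<otimes> g') = ?M #> (h [^] d \<otimes> h' [^] d)"
    using Q.hom_mult[OF g g'] Q.hom_mult[of "h [^] d" "h' [^] d"] h h' hc hc' by simp
  also have "\<dots> = ?M #> (h \<otimes> h') [^] d"
    using rcos_pow_mult[OF assms h(1) h'(1)] by simp
  finally show "g \<otimes> g' \<in> power_mod n d"
    using g g' h(1) h'(1) L by (auto simp: power_mod_def subgroup.m_closed)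
qed (auto simp: power_mod_def)

lemma pow_in_power_mod:
  "h \<in> lower_central G n \<Longrightarrow> h [^] d \<in> power_mod n d"
  using lower_central_closed by (auto simp: power_mod_def)

lemma lower_central_subset_power_mod: "lower_central G (Suc n) \<subseteq> power_mod n d"
proof
  fix g assume "g \<in> lower_central G (Suc n)"
  then have "g \<in> carrier G" "lower_central G (Suc n) #> g = lower_central G (Suc n) #> \<one> [^] d"
    using lower_central_closed[of g] rcos_eq_iff[of "lower_central G (Suc n)" g \<one>]
    by (auto simp: lower_central_subgroup)
  moreover have "\<one> \<in> lower_central G n"
    using lower_central_subgroup by (rule subgroup.one_closed)
  ultimately show "g \<in> power_mod n d"
    unfolding power_mod_def by blast
qed

lemma power_mod_subset:
  "power_mod n d \<subseteq> lower_central G n"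
proof
  fix g assume "g \<in> power_mod n d"
  then obtain h where g: "g \<in> carrier G" and h: "h \<in> lower_central G n" "lower_central G (Suc n) #> g = lower_central G (Suc n) #> h [^] d"
    by (auto simp: power_mod_def)
  have "h [^] d \<in> lower_central G n"
    using subgroup_int_pow_closed[OF lower_central_subgroup h(1), of "int d"] by (simp add: int_pow_int)
  then show "g \<in> lower_central G n"
    using mem_iff_if_rcos_eq[OF lower_central_subgroup lower_central_subgroup _ g _ h(2)] lower_central_antimono[of n "Suc n"]
      lower_central_closed by auto
qed

lemma power_mod_normal: "n \<ge> 1 \<Longrightarrow> power_mod n d \<lhd> G"
  using power_mod_subgroup lower_central_subset_power_mod power_mod_subset
  by (intro normal_between_lower_central)

text \<open>If g is h^d modulo gamma_{c+2}, then [g, f] is [h, f]^d modulo gamma_{c+3}.\<close>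

lemma iter_comm_subset_power_mod:
  assumes "N \<subseteq> power_mod 1 d"
  shows "iter_comm G N c \<subseteq> power_mod (Suc c) d"
proof (induction c)
  case (Suc c)
  let ?P = "power_mod (Suc (Suc c)) d"
  have P: "?P \<lhd> G" "subgroup ?P G"
    using power_mod_normal power_mod_subgroup by auto
  have "comm_subgroup G (iter_comm G N c) (carrier G) \<subseteq> ?P"
  proof (rule comm_subgroup_least[OF P(2)])
    fix g f assume g: "g \<in> iter_comm G N c" and f: "f \<in> carrier G"
    let ?M = "lower_central G (Suc (Suc c))"
    obtain h where gc: "g \<in> carrier G" and h: "h \<in> lower_central G (Suc c)" "?M #> g = ?M #> h [^] d"
      using Suc g by (auto simp: power_mod_def)
    have hc: "h \<in> carrier G"
      using h lower_central_closed by blast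
    \<comment> \<open>\<open>T\<close> is a subgroup containing \<open>?M\<close>, so membership
      passes from \<open>h [^] d\<close> to \<open>g\<close>, which lies in the same coset of
      \<open>?M\<close>.\<close>
    define T where "T = {g \<in> carrier G. commutator G g f \<in> ?P}"
    have T: "subgroup T G"
      unfolding T_def using P(1) f by (rule subgroup_commutator_left)
    have "commutator G t f \<in> ?P" if "t \<in> ?M" for t
      using that f lower_central_subset_power_mod[of "Suc (Suc c)" d]
      by (auto simp: lower_central_Suc intro: commutator_in_comm_subgroup)
    then have M: "?M \<subseteq> T"
      using lower_central_closed by (auto simp: T_def)
    have "commutator G h f \<in> ?M"
      using h f by (simp add: lower_central_Suc commutator_in_comm_subgroup)
    then have "commutator G h f [^] d \<in> ?P"
      by (rule pow_in_power_mod)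
    then have "commutator G (h [^] d) f \<in> ?P"
      using mem_iff_if_rcos_eq[OF lower_central_subgroup P(2) lower_central_subset_power_mod _ _ rcos_commutator_pow[OF _ h(1) f, of d]]
        hc f by simp
    then have "h [^] d \<in> T"
      using hc by (simp add: T_def)
    then have "g \<in> T"
      using mem_iff_if_rcos_eq[OF lower_central_subgroup T M gc _ h(2)] hc by simp
    then show "commutator G g f \<in> ?P"
      by (simp add: T_def)
  qed
  then show ?case by simp
qed (use assms in simp)

text \<open>Taking d-th powers is a homomorphism on the abelian quotient
  gamma_n/gamma_{n+1}.\<close>

lemma subgroup_pow_preimage:
  assumes n: "n \<ge> 1" and S: "subgroup S G" "lower_central G (Suc n) \<subseteq> S"
  shows "subgroup {h \<in> lower_central G n. h [^] (d :: nat) \<in> S} G"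
proof (rule subgroupI)
  note L = lower_central_subgroup[of n]
  have "\<one> \<in> {h \<in> lower_central G n. h [^] d \<in> S}"
    using L S(1) by (simp add: subgroup.one_closed)
  then show "{h \<in> lower_central G n. h [^] d \<in> S} \<noteq> {}" by blast
  fix g assume g: "g \<in> {h \<in> lower_central G n. h [^] d \<in> S}"
  then show "inv g \<in> {h \<in> lower_central G n. h [^] d \<in> S}"
    using L S(1) lower_central_closed by (auto simp: nat_pow_inv subgroup.m_inv_closed)
  fix h assume h: "h \<in> {h \<in> lower_central G n. h [^] d \<in> S}"
  have c: "g \<in> carrier G" "h \<in> carrier G"
    using g h lower_central_closed by auto
  have "(g \<otimes> h) [^] d \<in> S"
    using mem_iff_if_rcos_eq[OF lower_central_subgroup S _ _ rcos_pow_mult[OF n, of g h d]] g h c S(1)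
    by (simp add: subgroup.m_closed)
  then show "g \<otimes> h \<in> {h \<in> lower_central G n. h [^] d \<in> S}"
    using g h L by (simp add: subgroup.m_closed)
qed (auto intro: lower_central_closed)

text \<open>Bezout's identity in the exponents; the source of d in the result.\<close>

lemma pow_gcd_closed:
  assumes S: "subgroup S G" and g: "g \<in> carrier G" "g [^] (r :: nat) \<in> S" "g [^] (s :: nat) \<in> S"
  shows "g [^] gcd r s \<in> S"
proof -
  obtain u v :: int where uv: "u * int r + v * int s = gcd (int r) (int s)"
    using bezout_int by blast
  have "(g [^] int r) [^] u \<otimes> (g [^] int s) [^] v \<in> S"
    using g S by (simp add: int_pow_int subgroup.m_closed subgroup_int_pow_closed)
  also have "(g [^] int r) [^] u \<otimes> (g [^] int s) [^] v = g [^] int (gcd r s)"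
    using g(1) uv by (simp add: int_pow_pow mult.commute flip: int_pow_mult)
  finally show ?thesis
    by (simp add: int_pow_int)
qed

text \<open>In the induction step [w, f]^d is compared with [w^d, f]. They agree modulo gamma_{c+3},
  and this error term is already in the target because N contains gamma_2.\<close>

lemma pow_lower_central_in_iter_comm:
  assumes N: "N \<lhd> G" "lower_central G 2 \<subseteq> N"
    and base: "\<And>h. h \<in> lower_central G 2 \<Longrightarrow> h [^] (d :: nat) \<in> iter_comm G N 1"
    and "c \<ge> 1" "h \<in> lower_central G (Suc c)"
  shows "h [^] d \<in> iter_comm G N c"
  using assms(4,5)
proof (induction c arbitrary: h rule: nat_induct_at_least)
  case base
  then show ?case
    using assms(3) by (simp add: numeral_2_eq_2)
next
  case (Suc c)
  let ?W = "iter_comm G N (Suc c)"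
  have W: "subgroup ?W G"
    using N(1) iter_comm_normal normal_imp_subgroup by blast
  have sub: "lower_central G (Suc (Suc (Suc c))) \<subseteq> ?W"
    using iter_comm_mono[OF N(2), of "Suc c"] iter_comm_lower_central[of 2 "Suc c"] by (simp add: numeral_2_eq_2)
  have "lower_central G (Suc (Suc c)) \<subseteq> {h \<in> lower_central G (Suc (Suc c)). h [^] d \<in> ?W}"
    unfolding lower_central_Suc[of "Suc c", simplified]
  proof (rule comm_subgroup_least)
    show "subgroup {h \<in> comm_subgroup G (lower_central G (Suc c)) (carrier G). h [^] d \<in> ?W} G"
      using subgroup_pow_preimage[OF _ W sub, of d] by (simp add: lower_central_Suc)
  next
    fix w f assume w: "w \<in> lower_central G (Suc c)" and f: "f \<in> carrier G"
    have "commutator G (w [^] d) f \<in> ?W"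
      using Suc.IH[OF w] f by (simp add: commutator_in_comm_subgroup)
    then have "commutator G w f [^] d \<in> ?W"
      using mem_iff_if_rcos_eq[OF lower_central_subgroup W sub _ _ rcos_commutator_pow[OF _ w f, of d]] w f lower_central_closed
      by simp
    then show "commutator G w f \<in> {h \<in> comm_subgroup G (lower_central G (Suc c)) (carrier G). h [^] d \<in> ?W}"
      using w f by (simp add: commutator_in_comm_subgroup)
  qed
  then show ?case
    using Suc.prems by blast
qed

lemma power_mod_subset_iter_comm:
  assumes "N \<lhd> G" "lower_central G 2 \<subseteq> N"
    and "\<And>h. h \<in> lower_central G 2 \<Longrightarrow> h [^] (d :: nat) \<in> iter_comm G N 1"
    and "c \<ge> 1"
  shows "power_mod (Suc c) d \<subseteq> iter_comm G N c"
proof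
  have W: "subgroup (iter_comm G N c) G"
    using assms(1) iter_comm_normal normal_imp_subgroup by blast
  have sub: "lower_central G (Suc (Suc c)) \<subseteq> iter_comm G N c"
    using iter_comm_mono[OF assms(2), of c] iter_comm_lower_central[of 2 c] by (simp add: numeral_2_eq_2)
  fix g assume "g \<in> power_mod (Suc c) d"
  then obtain h where g: "g \<in> carrier G" and h: "h \<in> lower_central G (Suc c)"
    and gh: "lower_central G (Suc (Suc c)) #> g = lower_central G (Suc (Suc c)) #> h [^] d"
    by (auto simp: power_mod_def)
  have "h [^] d \<in> carrier G"
    using h lower_central_closed by blast
  then show "g \<in> iter_comm G N c"
    using mem_iff_if_rcos_eq[OF lower_central_subgroup W sub g _ gh] pow_lower_central_in_iter_comm[OF assms h]
    by blast
qed

section \<open>Normal closures and the two-generator case\<close>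

lemma normal_closure_normal:
  assumes "S \<subseteq> carrier G"
  shows "normal_closure G S \<lhd> G"
  unfolding normal_closure_def
proof (rule normal_generateI)
  show "(\<Union>g\<in>carrier G. \<Union>s\<in>S. {g \<otimes> s \<otimes> inv g}) \<subseteq> carrier G"
    using assms by auto
  fix h g assume "h \<in> (\<Union>g\<in>carrier G. \<Union>s\<in>S. {g \<otimes> s \<otimes> inv g})" and g: "g \<in> carrier G"
  then obtain k s where ks: "k \<in> carrier G" "s \<in> S" "h = k \<otimes> s \<otimes> inv k"
    by blast
  then have "g \<otimes> h \<otimes> inv g = (g \<otimes> k) \<otimes> s \<otimes> inv (g \<otimes> k)"
    using g assms by (auto simp: m_assoc inv_mult_group subset_iff)
  then show "g \<otimes> h \<otimes> inv g \<in> (\<Union>g\<in>carrier G. \<Union>s\<in>S. {g \<otimes> s \<otimes> inv g})"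
    using g ks by blast
qed

lemma subset_normal_closure:
  assumes "S \<subseteq> carrier G"
  shows "S \<subseteq> normal_closure G S"
proof
  fix s assume s: "s \<in> S"
  then have "\<one> \<otimes> s \<otimes> inv \<one> \<in> normal_closure G S"
    unfolding normal_closure_def by (intro generate.incl) blast
  then show "s \<in> normal_closure G S"
    using s assms by (auto simp: subset_iff)
qed

lemma normal_closure_least:
  "N \<lhd> G \<Longrightarrow> S \<subseteq> N \<Longrightarrow> normal_closure G S \<subseteq> N"
  unfolding normal_closure_def
  by (intro generate_subgroup_incl) (auto dest: normal_invE)

end

text \<open>One inclusion holds because r and s are multiples of d. For the other it suffices that
  [N, G] contains the d-th powers of gamma_2, and modulo gamma_3 the group gamma_2 is generated by
  the single commutator of the two generators.\<close>

lemma (in generated_group) iter_comm_two_generators: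
  assumes q: "q = 2" and c: "c \<ge> 1"
    and N_def: "N = normal_closure G ({\<xi> 0 [^] r, \<xi> 1 [^] s} \<union> lower_central G 2)"
  shows "iter_comm G N c = power_mod (c + 1) (gcd r s)" "N \<lhd> G" "lower_central G 2 \<subseteq> N"
proof -
  let ?d = "gcd r s" and ?S = "{\<xi> 0 [^] r, \<xi> 1 [^] s} \<union> lower_central G 2"
  have \<xi>: "\<xi> 0 \<in> carrier G" "\<xi> 1 \<in> carrier G"
    using gens_closed q by auto
  have SC: "?S \<subseteq> carrier G"
    using \<xi> lower_central_closed by auto
  show N: "N \<lhd> G"
    unfolding N_def by (rule normal_closure_normal[OF SC])
  have SN: "?S \<subseteq> N"
    unfolding N_def by (rule subset_normal_closure[OF SC])
  then show L2: "lower_central G 2 \<subseteq> N"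
    by blast
  have "N \<subseteq> power_mod 1 ?d"
    unfolding N_def
  proof (rule normal_closure_least)
    show "power_mod 1 ?d \<lhd> G"
      by (rule power_mod_normal) simp
    have "g [^] k \<in> power_mod 1 ?d" if "g \<in> carrier G" "?d dvd k" for g and k :: nat
    proof -
      obtain m where "k = m * ?d"
        using \<open>?d dvd k\<close> by (metis dvd_div_mult_self)
      then have "g [^] k = (g [^] m) [^] ?d"
        using that by (simp add: nat_pow_pow)
      then show ?thesis
        using that by (simp add: pow_in_power_mod lower_central_1)
    qed
    then show "?S \<subseteq> power_mod 1 ?d"
      using \<xi> lower_central_subset_power_mod[of 1 ?d] by (auto simp: numeral_2_eq_2)
  qed
  then have sub: "iter_comm G N c \<subseteq> power_mod (Suc c) ?d"
    by (rule iter_comm_subset_power_mod)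
  let ?W = "iter_comm G N 1"
  have W: "?W \<lhd> G" "subgroup ?W G"
    using N iter_comm_normal normal_imp_subgroup by blast+
  have L3: "lower_central G 3 \<subseteq> ?W"
    using iter_comm_mono[OF L2, of 1] iter_comm_lower_central[of 2 1] by simp
  \<comment> \<open>The elements of gamma_2 whose d-th power lies in [N, G]; the aim is that these
    are all of gamma_2.\<close>
  define Z where "Z = {h \<in> lower_central G 2. h [^] ?d \<in> ?W}"
  have Z: "subgroup Z G"
    unfolding Z_def using subgroup_pow_preimage[of 2 ?W ?d] W L3 by simp
  have "lower_central G 3 \<subseteq> Z"
  proof
    fix h assume h: "h \<in> lower_central G 3"
    then have "h [^] ?d \<in> lower_central G 3"
      using subgroup_int_pow_closed[OF lower_central_subgroup, of h 3 "int ?d"] by (simp add: int_pow_int)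
    then show "h \<in> Z"
      using h L3 lower_central_antimono[of 2 3] by (auto simp: Z_def)
  qed
  then have ZN: "Z \<lhd> G"
    using Z by (intro normal_between_lower_central[of 2]) (auto simp: Z_def)
  have comm2: "commutator G f g \<in> lower_central G 2" if "f \<in> carrier G" "g \<in> carrier G" for f g
    using that by (simp add: numeral_2_eq_2 lower_central_Suc lower_central_1 commutator_in_comm_subgroup)
  \<comment> \<open>Modulo gamma_3, which lies in [N, G], the power [f, g]^k equals [f^k, g], and
    the latter is in [N, G] as soon as f^k is in N.\<close>
  have pow_comm: "commutator G f g [^] k \<in> ?W" if "f \<in> carrier G" "g \<in> carrier G" "f [^] k \<in> N" for f g and k :: nat
  proof -
    have "commutator G (f [^] k) g \<in> ?W"
      using that by (simp add: commutator_in_comm_subgroup)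
    then show ?thesis
      using that L3 mem_iff_if_rcos_eq[OF lower_central_subgroup[of 3] W(2) L3 _ _ rcos_commutator_pow[of 1 f g k, simplified, folded numeral_3_eq_3]]
      by (simp add: lower_central_1)
  qed
  \<comment> \<open>The relator with exponent r gives the r-th power directly. The one with exponent
    s gives the s-th power of the inverse commutator, and Bezout combines the two.\<close>
  have 01: "commutator G (\<xi> 0) (\<xi> 1) \<in> Z"
  proof -
    have "commutator G (\<xi> 0) (\<xi> 1) [^] r \<in> ?W"
      using \<xi> SN by (intro pow_comm) auto
    moreover have "commutator G (\<xi> 1) (\<xi> 0) [^] s \<in> ?W"
      using \<xi> SN by (intro pow_comm) auto
    then have "inv (commutator G (\<xi> 1) (\<xi> 0) [^] s) \<in> ?W"
      using W by (simp add: subgroup.m_inv_closed)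
    then have "commutator G (\<xi> 0) (\<xi> 1) [^] s \<in> ?W"
      using \<xi> by (simp add: inv_commutator flip: nat_pow_inv)
    ultimately have "commutator G (\<xi> 0) (\<xi> 1) [^] ?d \<in> ?W"
      using \<xi> by (intro pow_gcd_closed W) auto
    then show ?thesis
      using \<xi> comm2 by (simp add: Z_def)
  qed
  \<comment> \<open>Two generators leave only trivial commutators, the one just treated and its
    inverse.\<close>
  have gens: "commutator G (\<xi> i) (\<xi> j) \<in> Z" if ij: "i < q" "j < q" for i j
  proof -
    consider "i = j" | "i = 0" "j = 1" | "i = 1" "j = 0"
      using ij q by linarith
    then show ?thesis
      using 01 \<xi> Z ij gens_closed commutator_swap_iff[OF Z \<xi>]
      by cases (auto simp: subgroup.one_closed)
  qed
  have all: "commutator G f g \<in> Z" if "f \<in> carrier G" "g \<in> carrier G" for f g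
  proof -
    \<comment> \<open>Normality of \<open>Z\<close> extends membership from generators to arbitrary
      elements in one argument at a time.\<close>
    have 1: "commutator G (\<xi> i) g \<in> Z" if "i < q" "g \<in> carrier G" for i g
    proof -
      have i: "\<xi> i \<in> carrier G"
        using gens_closed that by auto
      have "generate G (\<xi> ` {..<q}) \<subseteq> {g \<in> carrier G. commutator G g (\<xi> i) \<in> Z}"
        using gens \<open>i < q\<close> gens_closed
        by (intro generate_subgroup_incl subgroup_commutator_left ZN i) auto
      then have "commutator G g (\<xi> i) \<in> Z"
        using that generates by auto
      then show ?thesis
        using commutator_swap_iff[OF Z] that i by blast
    qed
    have "generate G (\<xi> ` {..<q}) \<subseteq> {f \<in> carrier G. commutator G f g \<in> Z}"
      using 1 that gens_closed
      by (intro generate_subgroup_incl subgroup_commutator_left ZN) auto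
    then show ?thesis
      using that generates by auto
  qed
  have "lower_central G 2 \<subseteq> Z"
    unfolding numeral_2_eq_2 lower_central_Suc[of "Suc 0", simplified] lower_central_1
    by (rule comm_subgroup_least[OF Z]) (rule all)
  then have "power_mod (Suc c) ?d \<subseteq> iter_comm G N c"
    using c by (intro power_mod_subset_iter_comm N L2) (auto simp: Z_def)
  with sub show "iter_comm G N c = power_mod (c + 1) ?d"
    by simp
qed

text \<open>The isomorphism reads the integer coordinates modulo d. If all coordinates of g are
  divisible by d, dividing them gives the coordinates of some h, and g h^-d has zero leading term,
  so it lies in gamma_{n+1}. Conversely, d-th powers multiply coordinates by d.\<close>

lemma (in magnus) lower_central_mod_power_iso:
  assumes n: "n \<ge> 1" and d: "d \<ge> 1"
  shows "G\<lparr>carrier := lower_central G n\<rparr> Mod power_mod n d \<cong>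
    sum_group {..<num_basic_commutators q n} (\<lambda>_. integer_mod_group d)"
proof -
  let ?L = "G\<lparr>carrier := lower_central G n\<rparr>"
  define k where "k = num_basic_commutators q n"
  let ?H = "sum_group {..<k} (\<lambda>_. integer_mod_group d)"
  obtain \<beta> where \<beta>: "bij_betw \<beta> {..<k} (basics q n)"
    using ex_bij_betw_nat_finite[OF finite_basics, of q n] by (auto simp: card_basics k_def atLeast0LessThan)
  have \<beta>B: "\<beta> i \<in> basics q n" if "i < k" for i
    using \<beta> that by (auto simp: bij_betw_def)
  define \<psi> where "\<psi> g = (\<lambda>i\<in>{..<k}. coord n g (\<beta> i) mod int d)" for g
  \<comment> \<open>Positivity of d matters: \<open>integer_mod_group 0\<close> consists of all
    integers instead of the residues below d.\<close>
  have carrier_H: "carrier ?H = {..<k} \<rightarrow>\<^sub>E {0..<int d}"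
    using d by (auto simp: carrier_sum_group carrier_integer_mod_group)
  interpret L: group ?L
    using lower_central_subgroup by (rule subgroup_imp_group)
  have coord_mult: "coord n (g \<otimes> h) b = coord n g b + coord n h b"
    if "g \<in> lower_central G n" "h \<in> lower_central G n" "b \<in> basics q n" for g h b
  proof (rule coord_unique[OF n _ _ that(3)])
    show "g \<otimes> h \<in> lower_central G n"
      using that lower_central_subgroup by (simp add: subgroup.m_closed)
    show "lead n (g \<otimes> h) = (\<Sum>b\<in>basics q n. (coord n g b + coord n h b) *\<^sub>R lie b)"
      using that n by (simp add: lead_mult lead_coord scaleR_left_distrib sum.distrib)
  qed
  have "\<psi> \<in> hom ?L ?H"
  proof (rule homI)
    fix g assume "g \<in> carrier ?L"
    then show "\<psi> g \<in> carrier ?H"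
      using d by (auto simp: carrier_H \<psi>_def)
  next
    fix g h assume "g \<in> carrier ?L" "h \<in> carrier ?L"
    then show "\<psi> (g \<otimes>\<^bsub>?L\<^esub> h) = \<psi> g \<otimes>\<^bsub>?H\<^esub> \<psi> h"
      using \<beta>B by (auto simp: \<psi>_def coord_mult mod_add_eq)
  qed
  then interpret \<psi>: group_hom ?L ?H \<psi>
    by (intro group_hom.intro L.is_group group_hom_axioms.intro) simp_all
  have "\<psi> ` carrier ?L = carrier ?H"
  proof
    show "carrier ?H \<subseteq> \<psi> ` carrier ?L"
    proof
      fix z assume z: "z \<in> carrier ?H"
      obtain g where g: "g \<in> lower_central G n"
        \<comment> \<open>The residues in \<open>z\<close> are already integers and serve as
          coordinates, transported to basic commutators by the inverse of the enumeration
          \<open>\<beta>\<close>.\<close>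
        "lead n g = (\<Sum>b\<in>basics q n. z (inv_into {..<k} \<beta> b) *\<^sub>R lie b)"
        using ex_coord[OF n, of "\<lambda>b. z (inv_into {..<k} \<beta> b)"] by blast
      have "coord n g (\<beta> i) = z i" if "i < k" for i
        using coord_unique[OF n g \<beta>B[OF that]] \<beta> that by (simp add: bij_betw_def)
      then have "\<psi> g = z"
        using z by (auto simp: \<psi>_def carrier_H PiE_iff extensional_def)
      then show "z \<in> \<psi> ` carrier ?L"
        using g(1) by auto
    qed
  qed auto
  moreover have "kernel ?L ?H \<psi> = power_mod n d"
  proof -
    have iff: "\<psi> g = \<one>\<^bsub>?H\<^esub> \<longleftrightarrow> (\<forall>b\<in>basics q n. int d dvd coord n g b)" for g
    proof -
      have "\<psi> g = \<one>\<^bsub>?H\<^esub> \<longleftrightarrow> (\<forall>i\<in>{..<k}. int d dvd coord n g (\<beta> i))"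
        by (auto simp: \<psi>_def fun_eq_iff)
      also have "\<dots> \<longleftrightarrow> (\<forall>b\<in>\<beta> ` {..<k}. int d dvd coord n g b)"
        by blast
      also have "\<beta> ` {..<k} = basics q n"
        using \<beta> by (simp add: bij_betw_def)
      finally show ?thesis .
    qed
    have "(\<forall>b\<in>basics q n. int d dvd coord n g b) \<longleftrightarrow> g \<in> power_mod n d" if g: "g \<in> lower_central G n" for g
    proof
      assume dvd: "\<forall>b\<in>basics q n. int d dvd coord n g b"
      have "real d * real_of_int (coord n g b div int d) = real_of_int (coord n g b)" if "b \<in> basics q n" for b
        using dvd that by (metis dvd_mult_div_cancel of_int_mult of_int_of_nat_eq)
      then have eq: "lead n g = (\<Sum>b\<in>basics q n. (real d * real_of_int (coord n g b div int d)) *\<^sub>R lie b)"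
        unfolding lead_coord[OF n g] by (intro sum.cong) simp_all
      obtain h where h: "h \<in> lower_central G n" "lead n h = (\<Sum>b\<in>basics q n. (coord n g b div d) *\<^sub>R lie b)"
        using ex_coord[OF n, of "\<lambda>b. coord n g b div int d"] by blast
      have hd: "h [^] d \<in> lower_central G n" "inv (h [^] d) \<in> lower_central G n"
        using h lower_central_nat_pow_closed lower_central_subgroup by (auto intro: subgroup.m_inv_closed)
      have "lead n (g \<otimes> inv (h [^] d)) = lead n g - real d *\<^sub>R lead n h"
        using n g h hd by (simp add: lead_mult lead_inv lead_nat_pow)
      also have "\<dots> = 0"
        by (simp add: eq h scaleR_sum_right)
      finally have "g \<otimes> inv (h [^] d) \<in> lower_central G (Suc n)"
        using n g hd lower_central_subgroup by (intro lead_eq_0) (auto intro: subgroup.m_closed)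
      then show "g \<in> power_mod n d"
        using g h rcos_eq_iff[OF lower_central_subgroup] lower_central_closed by (auto simp: power_mod_def)
    next
      assume "g \<in> power_mod n d"
      then obtain h where h: "h \<in> lower_central G n"
        "lower_central G (Suc n) #> g = lower_central G (Suc n) #> h [^] d"
        by (auto simp: power_mod_def)
      have hd: "h [^] d \<in> lower_central G n" "inv (h [^] d) \<in> lower_central G n"
        using h lower_central_nat_pow_closed lower_central_subgroup by (auto intro: subgroup.m_inv_closed)
      have "g \<otimes> inv (h [^] d) \<in> lower_central G (Suc n)"
        using g h hd rcos_eq_iff[OF lower_central_subgroup] lower_central_closed by blast
      then have "lead n (g \<otimes> inv (h [^] d)) = 0"
        using n by (rule lead_lower_central_Suc[rotated])
      then have "lead n g = real d *\<^sub>R lead n h"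
        using n g h hd by (simp add: lead_mult lead_inv lead_nat_pow)
      then have "lead n g = (\<Sum>b\<in>basics q n. (d * coord n h b) *\<^sub>R lie b)"
        using n h by (simp add: lead_coord scaleR_sum_right)
      from coord_unique[OF n g this] show "\<forall>b\<in>basics q n. int d dvd coord n g b"
        by simp
    qed
    then show ?thesis
      using iff power_mod_subset[of n d] by (auto simp: kernel_def)
  qed
  ultimately show ?thesis
    using \<psi>.FactGroup_iso by (simp add: k_def)
qed

text \<open>The universal property extends the Magnus assignment on the two generators. Distinctness
  of \<open>x\<close> and \<open>y\<close> lets them be sent to different variables.\<close>

lemma magnus_free_group:
  fixes x y :: 'a
  assumes "x \<noteq> y"
  obtains \<mu> where "magnus (free_group {x, y}) (\<lambda>i. free_gen (if i = 0 then x else y)) 2 \<mu>"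
proof -
  let ?F = "free_group {x, y}" and ?\<xi> = "\<lambda>i :: nat. free_gen (if i = 0 then x else y)"
  let ?\<phi> = "\<lambda>a. 1 + var (if a = x then 0 else 1)"
  interpret group ?F
    by (rule group_free_group)
  have img: "?\<xi> ` {..<2} = free_gen ` {x, y}"
    by (auto simp: lessThan_nat_numeral lessThan_Suc numeral_2_eq_2)
  interpret U: group series_units
    by (rule group_series_units)
  have "magnus ?F ?\<xi> 2 (word_eval series_units ?\<phi>)"
  proof unfold_locales
    show "?\<xi> ` {..<2} \<subseteq> carrier ?F"
      by (auto intro: free_gen_closed)
    show "generate ?F (?\<xi> ` {..<2}) = carrier ?F"
      by (simp only: img generate_free_group)
    show "word_eval series_units ?\<phi> \<in> hom ?F series_units"
      by (rule U.word_eval_hom) (auto intro: one_plus_var_unit)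
    fix i :: nat assume "i < 2"
    then show "word_eval series_units ?\<phi> (?\<xi> i) = 1 + var i"
      using assms by (subst U.word_eval_free_gen) (auto intro: one_plus_var_unit simp: less_2_cases_iff)
  qed
  then show thesis
    using that by blast
qed

theorem theorem3p1:
  fixes r s c :: nat
    and x y :: 'a
    and F :: "'b monoid"
    and R :: "'b set"
  assumes "r \<ge> 1" and "s \<ge> 1" and "c \<ge> 1"
    and "x \<noteq> y"
    and "free_presentation F R (G_rs1 x y r s)"
  shows "baer_invariant c F R \<cong>
    sum_group {..<num_basic_commutators 2 (c + 1)} (\<lambda>_. integer_mod_group (gcd r s))"
proof -
  define P where "P = free_group {x, y}"
  let ?\<xi> = "\<lambda>i :: nat. free_gen (if i = 0 then x else y)"
  obtain \<mu> where "magnus P ?\<xi> 2 \<mu>"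
    using magnus_free_group[OF \<open>x \<noteq> y\<close>] by (auto simp: P_def)
  then interpret P: magnus P ?\<xi> 2 \<mu> .
  define N where "N = normal_closure P ({free_gen x [^]\<^bsub>P\<^esub> r, free_gen y [^]\<^bsub>P\<^esub> s} \<union> lower_central P 2)"
  have G: "G_rs1 x y r s = P Mod N"
    by (simp add: G_rs1_def presented_group_def P_def N_def Let_def)
  have iter: "iter_comm P N c = P.power_mod (c + 1) (gcd r s)" and N: "N \<lhd> P" and L2: "lower_central P 2 \<subseteq> N"
    using P.iter_comm_two_generators[of c N r s] \<open>c \<ge> 1\<close> by (simp_all add: N_def)
  obtain \<pi> where free: "is_free_group F" and F: "group F" and Gg: "group (P Mod N)"
    and \<pi>: "\<pi> \<in> epi F (P Mod N)" and ker: "kernel F (P Mod N) \<pi> = R"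
    using assms(5) by (auto simp: free_presentation_def is_free_group_def G)
  let ?\<rho> = "\<lambda>a. N #>\<^bsub>P\<^esub> a"
  interpret \<rho>: group_hom P "P Mod N" ?\<rho>
    using N by (rule P.group_hom_FactGroup)
  interpret F: group F by fact
  interpret \<pi>: group_hom F "P Mod N" \<pi>
    using \<pi> by unfold_locales (simp add: epi_def)
  have \<rho>: "?\<rho> \<in> epi P (P Mod N)"
    using \<rho>.homh by (simp add: epi_def carrier_FactGroup)
  have ker\<rho>: "kernel P (P Mod N) ?\<rho> = N"
    using N by (rule P.kernel_FactGroup)
  have R: "R \<lhd> F"
    using \<pi>.normal_kernel by (simp add: ker)
  obtain f where f: "f \<in> hom F P" "\<And>w. w \<in> carrier F \<Longrightarrow> ?\<rho> (f w) = \<pi> w"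
    using is_free_group_lift[OF free Gg P.is_group \<pi>.homh \<rho>] by blast
  \<comment> \<open>Both free groups are projective and both map onto the same quotient, so lifts of
    the identity exist in both directions.\<close>
  obtain g where g: "g \<in> hom P F" "\<And>w. w \<in> carrier P \<Longrightarrow> \<pi> (g w) = ?\<rho> w"
  proof -
    have "?\<rho> \<in> hom (free_group {x, y}) (P Mod N)"
      using \<rho>.homh by (simp only: P_def)
    from free_group_lift[OF Gg F this \<pi>] show thesis
      using that unfolding P_def by blast
  qed
  have fc: "f w \<in> carrier P" if "w \<in> carrier F" for w
    using f(1) that by (auto simp: hom_def)
  have gc: "g w \<in> carrier F" if "w \<in> carrier P" for w
    using g(1) that by (auto simp: hom_def)
  have "baer_invariant c F R \<cong> baer_invariant c P N"
  proof (rule baer_invariant_iso[OF F P.is_group R N f(1) _ g(1)])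
    show "f ` R \<subseteq> N"
    proof clarify
      fix w assume "w \<in> R"
      then have w: "w \<in> carrier F" "\<pi> w = \<one>\<^bsub>P Mod N\<^esub>"
        by (auto simp flip: ker simp: kernel_def)
      then have "f w \<in> kernel P (P Mod N) ?\<rho>"
        using f(2) fc by (simp add: kernel_def)
      then show "f w \<in> N"
        by (simp only: ker\<rho>)
    qed
    show "g ` N \<subseteq> R"
    proof clarify
      fix w assume "w \<in> N"
      then have "w \<in> kernel P (P Mod N) ?\<rho>"
        by (simp only: ker\<rho>)
      then have "g w \<in> kernel F (P Mod N) \<pi>"
        using g(2) gc by (simp add: kernel_def)
      then show "g w \<in> R"
        by (simp only: ker)
    qed
    fix w assume w: "w \<in> carrier F"
    \<comment> \<open>The lifting equations give \<pi>(g(f(w))) = \<rho>(f(w)) = \<pi>(w).\<close>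
    have "\<pi> (g (f w) \<otimes>\<^bsub>F\<^esub> inv\<^bsub>F\<^esub> w) = \<one>\<^bsub>P Mod N\<^esub>"
      using w fc gc f(2) g(2) by (simp del: mult_FactGroup one_FactGroup)
    then show "g (f w) \<otimes>\<^bsub>F\<^esub> inv\<^bsub>F\<^esub> w \<in> R"
      using w fc gc unfolding ker[symmetric] kernel_def by simp
  next
    fix w assume w: "w \<in> carrier P"
    have "?\<rho> (f (g w)) = ?\<rho> w"
      using w gc f(2) g(2) by simp
    then show "f (g w) \<otimes>\<^bsub>P\<^esub> inv\<^bsub>P\<^esub> w \<in> N"
      using w gc fc P.rcos_eq_iff[OF normal_imp_subgroup[OF N]] by blast
  qed
  also have "baer_invariant c P N = P\<lparr>carrier := lower_central P (c + 1)\<rparr> Mod P.power_mod (c + 1) (gcd r s)"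
  proof -
    \<comment> \<open>Since c is at least 1, gamma_{c+1} is contained in gamma_2, which consists of
      relators; the numerator is therefore all of gamma_{c+1}.\<close>
    have "lower_central P (c + 1) \<subseteq> N"
      using L2 P.lower_central_antimono[of 2 "c + 1"] \<open>c \<ge> 1\<close> by auto
    then have "N \<inter> lower_central P (c + 1) = lower_central P (c + 1)"
      by blast
    then show ?thesis
      by (simp only: baer_invariant_def iter)
  qed
  finally show ?thesis
    using P.lower_central_mod_power_iso[of "c + 1" "gcd r s"] \<open>r \<ge> 1\<close>
    by (auto intro: iso_trans simp: Suc_le_eq)
qed

end
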